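(* Let $w$ be a permutation avoiding the pattern $1423$, and let $u$ be a subword of $w$. Then $$\sum_{u\le v\le w}(-1)^{|w|-|v|}\,\Upsilon_{\mathrm{perm}(v)}(\beta)\in\mathbb{Z}_{\ge0}[\beta],$$ where the sum is over all subwords $v$ of $w$ that contain $u$ as a subword.
   Context: For $w\in S_n$, the $\beta$-Grothendieck polynomial $\mathfrak{G}^{(\beta)}_w(x)\in\mathbb{Z}[\beta][x_1,\dots,x_n]$ is defined by $\mathfrak{G}^{(\beta)}_{w_0}=x_1^{n-1}\cdots x_{n-1}$ for $w_0=n\cdots21$ and $\mathfrak{G}^{(\beta)}_w=\pi_i\mathfrak{G}^{(\beta)}_{ws_i}$ whenever $w(i)<w(i+1)$, where $\pi_i(f)=\partial_i((1+\beta x_{i+1})f)$, $\partial_if=(f-s_if)/(x_i-x_{i+1})$. $\Upsilon_w(\beta)=\mathfrak{G}^{(\beta)}_w(1,\dots,1)$, $\Upsilon_\emptyset(\beta)=1$. Words have distinct positive integer entries; $u\le v$ means $u$ is a subword (subsequence) of $v$; $|v|$ is the length; $\mathrm{perm}(v)$ is the permutation order-isomorphic to $v$. $w$ avoids $1423$ if no subword $v$ of $w$ has $\mathrm{perm}(v)=1423$. *)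

theory Defs
  imports "HOL-Library.Poly_Mapping" "HOL-Library.Sublist" "HOL-Computational_Algebra.Polynomial"
begin

text \<open>Polynomials in x_1, x_2, ... with coefficients in Z[beta] (beta is the variable of int poly).
  A monomial is an exponent vector (finitely supported nat to nat); index i stands for the variable x_i.\<close>
type_synonym mpoly = "(nat \<Rightarrow>\<^sub>0 nat) \<Rightarrow>\<^sub>0 int poly"

definition mmono :: "int poly \<Rightarrow> (nat \<Rightarrow>\<^sub>0 nat) \<Rightarrow> mpoly" where
  "mmono c \<alpha> = Poly_Mapping.single \<alpha> c"

definition xvar :: "nat \<Rightarrow> mpoly" where
  "xvar i = mmono 1 (Poly_Mapping.single i 1)"

definition betaC :: mpoly where
  "betaC = mmono [:0, 1:] 0"

text \<open>Divided difference of the monomial c x^alpha: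
  (c x^alpha - s_i(c x^alpha)) / (x_i - x_(i+1)), written out explicitly.\<close>
definition dd_mono :: "nat \<Rightarrow> (nat \<Rightarrow>\<^sub>0 nat) \<Rightarrow> int poly \<Rightarrow> mpoly" where
  "dd_mono i \<alpha> c =
    (let a = Poly_Mapping.lookup \<alpha> i; b = Poly_Mapping.lookup \<alpha> (Suc i);
         r = \<alpha> - Poly_Mapping.single i a - Poly_Mapping.single (Suc i) b
     in if b < a then
          (\<Sum>k<a - b. mmono c (r + Poly_Mapping.single i (b + k) + Poly_Mapping.single (Suc i) (a - 1 - k)))
        else if a < b then
          - (\<Sum>k<b - a. mmono c (r + Poly_Mapping.single i (a + k) + Poly_Mapping.single (Suc i) (b - 1 - k)))
        else 0)"

definition divdiff :: "nat \<Rightarrow> mpoly \<Rightarrow> mpoly" where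
  "divdiff i f = (\<Sum>\<alpha>\<in>Poly_Mapping.keys f. dd_mono i \<alpha> (Poly_Mapping.lookup f \<alpha>))"

definition piop :: "nat \<Rightarrow> mpoly \<Rightarrow> mpoly" where
  "piop i f = divdiff i ((1 + betaC * xvar (Suc i)) * f)"

definition groth_top :: "nat \<Rightarrow> mpoly" where
  "groth_top n = mmono 1 (\<Sum>i\<in>{1..<n}. Poly_Mapping.single i (n - i))"

text \<open>Permutations in one-line notation as lists over {1..n}; positions are 1-indexed
  for s_i (swap of positions i and i+1, i.e. list indices i-1 and i).\<close>
definition swap_adj :: "nat list \<Rightarrow> nat \<Rightarrow> nat list" where
  "swap_adj w i = w[i - 1 := w ! i, i := w ! (i - 1)]"

text \<open>Recursion G_w = pi_i G_(w s_i), i the least ascent of w, starting from G_(w0).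
  Fuel bounds the number of steps (each step increases the inversion number).\<close>
primrec groth_aux :: "nat \<Rightarrow> nat list \<Rightarrow> mpoly" where
  "groth_aux 0 w = groth_top (length w)"
| "groth_aux (Suc k) w =
     (if w = rev [1..<Suc (length w)] then groth_top (length w)
      else (let i = (LEAST i. 0 < i \<and> i < length w \<and> w ! (i - 1) < w ! i)
            in piop i (groth_aux k (swap_adj w i))))"

definition groth :: "nat list \<Rightarrow> mpoly" where
  "groth w = groth_aux (length w ^ 2) w"

definition eval_ones :: "mpoly \<Rightarrow> int poly" where
  "eval_ones f = (\<Sum>\<alpha>\<in>Poly_Mapping.keys f. Poly_Mapping.lookup f \<alpha>)"

definition Upsilon :: "nat list \<Rightarrow> int poly" where
  "Upsilon w = eval_ones (groth w)"

definition std :: "nat list \<Rightarrow> nat list" where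
  "std v = map (\<lambda>x. card {y \<in> set v. y \<le> x}) v"

definition is_perm :: "nat list \<Rightarrow> bool" where
  "is_perm w \<longleftrightarrow> distinct w \<and> set w = {1..length w}"

definition avoids :: "nat list \<Rightarrow> nat list \<Rightarrow> bool" where
  "avoids w p \<longleftrightarrow> \<not> (\<exists>v. subseq v w \<and> std v = p)"

end

theory Submission
  imports Defs
begin

text \<open>
  Pipe dreams are the guide. Removing from a word \<open>L m R\<close> its smallest letter \<open>m\<close> (the first column of
  the pipe dream) expresses \<open>\<Upsilon>(L m R)\<close> as a combination of values \<open>\<Upsilon>(L R')\<close>. Here \<open>R'\<close> arises from
  reading \<open>R\<close> from right to left with a token: the token must be exchanged for a smaller letter, and
  on meeting a larger letter it either jumps over it (weight 1) or is exchanged for it (weight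
  \<open>1 + \<beta>\<close>). At the level of polynomials this is
  \<open>\<pi>\<^sub>j (x\<^sub>j f) = f + x\<^sub>j\<^sub>+\<^sub>1 (\<pi>\<^sub>j f + \<beta> f)\<close> applied along the positions of \<open>R\<close>.

  The alternating sum over subwords is carried along with this recursion. Call the letters outside
  \<open>u\<close> optional; an optional letter stands for the difference of the words with and without it.
  Avoidance of 1423 is not inherited by the words \<open>L R'\<close>, but a weaker property is: no occurrence of
  1423 has an optional letter in the role of 2. Indeed a token that has jumped is no longer optional,
  and only jumping tokens create new patterns. Under this property \<open>R\<close> has no 312 with an optional
  smallest letter, which is what makes every term of the recursion appear with a positive sign.
\<close>

section \<open>Isobaric divided differences\<close>

definition monom_eval :: "(nat \<Rightarrow> 'a::comm_ring_1) \<Rightarrow> (nat \<Rightarrow>\<^sub>0 nat) \<Rightarrow> 'a" where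
  "monom_eval z \<alpha> = (\<Prod>i\<in>Poly_Mapping.keys \<alpha>. z i ^ Poly_Mapping.lookup \<alpha> i)"

lemma monom_eval_superset:
  assumes "finite S" "Poly_Mapping.keys \<alpha> \<subseteq> S"
  shows "monom_eval z \<alpha> = (\<Prod>i\<in>S. z i ^ Poly_Mapping.lookup \<alpha> i)"
  unfolding monom_eval_def using assms
  by (intro prod.mono_neutral_left) (auto simp: in_keys_iff)

lemma monom_eval_add: "monom_eval z (\<alpha> + \<gamma>) = monom_eval z \<alpha> * monom_eval z \<gamma>"
proof -
  let ?S = "Poly_Mapping.keys \<alpha> \<union> Poly_Mapping.keys \<gamma>"
  have "Poly_Mapping.keys (\<alpha> + \<gamma>) \<subseteq> ?S" by (rule keys_add)
  then show ?thesis
    by (simp add: monom_eval_superset[of ?S] lookup_add power_add prod.distrib)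
qed

lemma monom_eval_0 [simp]: "monom_eval z 0 = 1"
  by (simp add: monom_eval_def)

lemma monom_eval_single [simp]: "monom_eval z (Poly_Mapping.single i n) = z i ^ n"
  by (simp add: monom_eval_def)

lemma monom_eval_cong:
  "(\<And>i. i \<in> Poly_Mapping.keys \<alpha> \<Longrightarrow> z i = z' i) \<Longrightarrow> monom_eval z \<alpha> = monom_eval z' \<alpha>"
  by (simp add: monom_eval_def)

text \<open>The simple transposition acts on points, so that s_i f becomes substitution of the
  swapped point into f.\<close>

definition swap_at :: "nat \<Rightarrow> (nat \<Rightarrow> 'a) \<Rightarrow> nat \<Rightarrow> 'a" where
  "swap_at i z = z(i := z (Suc i), Suc i := z i)"

lemma monom_eval_ones [simp]: "monom_eval (\<lambda>_. 1) \<alpha> = 1"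
  by (simp add: monom_eval_def)

lemma mpoly_expand: "f = (\<Sum>\<alpha>\<in>Poly_Mapping.keys f. mmono (Poly_Mapping.lookup f \<alpha>) \<alpha>)"
proof (rule poly_mapping_eqI)
  fix k
  show "Poly_Mapping.lookup f k =
    Poly_Mapping.lookup (\<Sum>\<alpha>\<in>Poly_Mapping.keys f. mmono (Poly_Mapping.lookup f \<alpha>) \<alpha>) k"
    by (cases "k \<in> Poly_Mapping.keys f")
      (auto simp: lookup_sum mmono_def lookup_single when_def in_keys_iff)
qed

text \<open>Factoring out (x y)^b leaves a geometric sum; this justifies the explicit quotient in
  \<open>dd_mono\<close>.\<close>

lemma power_swap_diff_sum:
  fixes x y :: "'a::comm_ring_1"
  assumes "b \<le> a"
  shows "(x - y) * (\<Sum>k<a - b. x ^ (b + k) * y ^ (a - 1 - k)) = x ^ a * y ^ b - y ^ a * x ^ b"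
proof -
  have "x ^ a * y ^ b - y ^ a * x ^ b = (x ^ b * y ^ b) * (x ^ (a - b) - y ^ (a - b))"
    using assms by (simp add: ring_distribs power_add[symmetric] mult_ac flip: power_add)
      (simp add: mult.assoc[symmetric] mult_ac flip: power_add)
  also have "\<dots> = (x - y) * (\<Sum>k<a - b. (x ^ b * y ^ b) * (y ^ (a - b - Suc k) * x ^ k))"
    by (simp add: power_diff_sumr2 sum_distrib_left mult_ac)
  also have "(\<Sum>k<a - b. (x ^ b * y ^ b) * (y ^ (a - b - Suc k) * x ^ k)) =
      (\<Sum>k<a - b. x ^ (b + k) * y ^ (a - 1 - k))"
  proof (rule sum.cong[OF refl])
    fix k assume "k \<in> {..<a - b}"
    then have "a - 1 - k = b + (a - b - Suc k)" by auto
    then show "(x ^ b * y ^ b) * (y ^ (a - b - Suc k) * x ^ k) = x ^ (b + k) * y ^ (a - 1 - k)"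
      by (simp add: power_add mult_ac)
  qed
  finally show ?thesis by simp
qed

text \<open>One notion of evaluation serves two purposes: with constants embedded into
  \<open>mpoly\<close> it permutes variables, and with the identity on coefficients it sets all
  variables to 1.\<close>

locale coeff_hom =
  fixes \<kappa> :: "int poly \<Rightarrow> 'a::comm_ring_1"
  assumes hom_add: "\<kappa> (a + b) = \<kappa> a + \<kappa> b"
    and hom_mult: "\<kappa> (a * b) = \<kappa> a * \<kappa> b"
    and hom_1: "\<kappa> 1 = 1"
begin

lemma hom_0: "\<kappa> 0 = 0"
  using hom_add[of 0 0] by simp

definition subst :: "(nat \<Rightarrow> 'a) \<Rightarrow> mpoly \<Rightarrow> 'a" where
  "subst z f = (\<Sum>\<alpha>\<in>Poly_Mapping.keys f. \<kappa> (Poly_Mapping.lookup f \<alpha>) * monom_eval z \<alpha>)"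

lemma subst_superset:
  assumes "finite S" "Poly_Mapping.keys f \<subseteq> S"
  shows "subst z f = (\<Sum>\<alpha>\<in>S. \<kappa> (Poly_Mapping.lookup f \<alpha>) * monom_eval z \<alpha>)"
  unfolding subst_def using assms
  by (intro sum.mono_neutral_left) (auto simp: in_keys_iff hom_0)

lemma subst_add: "subst z (f + g) = subst z f + subst z g"
proof -
  let ?S = "Poly_Mapping.keys f \<union> Poly_Mapping.keys g"
  have "Poly_Mapping.keys (f + g) \<subseteq> ?S" by (rule keys_add)
  then show ?thesis
    by (simp add: subst_superset[of ?S] lookup_add hom_add ring_distribs sum.distrib)
qed

lemma subst_0 [simp]: "subst z 0 = 0"
  by (simp add: subst_def)

lemma subst_sum: "subst z (sum f S) = (\<Sum>i\<in>S. subst z (f i))"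
  by (induction S rule: infinite_finite_induct) (auto simp: subst_add)

lemma subst_uminus: "subst z (- f) = - subst z f"
  using subst_add[of z f "- f"] by (simp add: eq_neg_iff_add_eq_0 add.commute)

lemma subst_mmono: "subst z (mmono c \<alpha>) = \<kappa> c * monom_eval z \<alpha>"
  by (simp add: subst_superset[of "{\<alpha>}"] mmono_def)

lemma subst_mult: "subst z (f * g) = subst z f * subst z g"
proof -
  have "f * g = (\<Sum>\<alpha>\<in>Poly_Mapping.keys f. \<Sum>\<gamma>\<in>Poly_Mapping.keys g.
      mmono (Poly_Mapping.lookup f \<alpha> * Poly_Mapping.lookup g \<gamma>) (\<alpha> + \<gamma>))"
    by (subst (1) mpoly_expand[of f], subst (1) mpoly_expand[of g])
      (simp add: sum_product mmono_def mult_single)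
  then have "subst z (f * g) = (\<Sum>\<alpha>\<in>Poly_Mapping.keys f. \<Sum>\<gamma>\<in>Poly_Mapping.keys g.
      (\<kappa> (Poly_Mapping.lookup f \<alpha>) * monom_eval z \<alpha>) * (\<kappa> (Poly_Mapping.lookup g \<gamma>) * monom_eval z \<gamma>))"
    by (simp add: subst_sum subst_mmono hom_mult monom_eval_add mult_ac)
  then show ?thesis by (simp add: subst_def sum_product)
qed

lemma subst_1 [simp]: "subst z 1 = 1"
  using subst_mmono[of z 1 0] by (simp add: mmono_def hom_1)

lemma subst_xvar [simp]: "subst z (xvar i) = z i"
  by (simp add: xvar_def subst_mmono hom_1)

lemma subst_prod: "subst z (prod f S) = (\<Prod>i\<in>S. subst z (f i))"
  by (induction S rule: infinite_finite_induct) (auto simp: subst_mult)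

definition hbeta :: 'a where "hbeta = \<kappa> [:0, 1:]"

lemma subst_betaC [simp]: "subst z betaC = hbeta"
  by (simp add: betaC_def subst_mmono hbeta_def)

lemma subst_dd_mono:
  "(z i - z (Suc i)) * subst z (dd_mono i \<alpha> c) =
    subst z (mmono c \<alpha>) - subst (swap_at i z) (mmono c \<alpha>)"
proof -
  define a b where "a = Poly_Mapping.lookup \<alpha> i" and "b = Poly_Mapping.lookup \<alpha> (Suc i)"
  define r where "r = \<alpha> - Poly_Mapping.single i a - Poly_Mapping.single (Suc i) b"
  define z' where "z' = swap_at i z"
  have \<alpha>: "\<alpha> = r + Poly_Mapping.single i a + Poly_Mapping.single (Suc i) b"
    by (rule poly_mapping_eqI)
      (auto simp: r_def lookup_add lookup_minus lookup_single when_def a_def b_def)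
  have r0: "i \<notin> Poly_Mapping.keys r" "Suc i \<notin> Poly_Mapping.keys r"
    by (auto simp: r_def in_keys_iff lookup_minus lookup_single when_def a_def b_def)
  have r': "monom_eval z' r = monom_eval z r"
    by (rule monom_eval_cong) (use r0 in \<open>auto simp: z'_def swap_at_def\<close>)
  have z': "z' i = z (Suc i)" "z' (Suc i) = z i" by (simp_all add: z'_def swap_at_def)
  have dd: "subst z (dd_mono i \<alpha> c) = \<kappa> c * monom_eval z r *
      (if b < a then (\<Sum>k<a - b. z i ^ (b + k) * z (Suc i) ^ (a - 1 - k))
       else - (\<Sum>k<b - a. z i ^ (a + k) * z (Suc i) ^ (b - 1 - k)))"
    unfolding dd_mono_def Let_def a_def[symmetric] b_def[symmetric] r_def[symmetric]
    by (simp add: subst_uminus subst_sum subst_mmono monom_eval_add sum_distrib_left mult_ac)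
  have rhs: "subst z (mmono c \<alpha>) - subst z' (mmono c \<alpha>) = \<kappa> c * monom_eval z r *
      (z i ^ a * z (Suc i) ^ b - z (Suc i) ^ a * z i ^ b)"
    by (subst (1 2) \<alpha>) (simp add: subst_mmono monom_eval_add r' z' algebra_simps)
  show ?thesis
  proof (cases "b < a")
    case True
    then show ?thesis
      using power_swap_diff_sum[of b a "z i" "z (Suc i)"]
      by (simp add: dd rhs[unfolded z'_def] mult.left_commute[of "z i - z (Suc i)"])
  next
    case False
    then have "(z i - z (Suc i)) * (\<Sum>k<b - a. z i ^ (a + k) * z (Suc i) ^ (b - 1 - k)) =
        z i ^ b * z (Suc i) ^ a - z (Suc i) ^ b * z i ^ a"
      by (intro power_swap_diff_sum) simp
    then show ?thesis using False
      by (simp add: dd rhs[unfolded z'_def] mult.left_commute[of "z i - z (Suc i)"]) (simp add: algebra_simps)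
  qed
qed

lemma subst_divdiff:
  "(z i - z (Suc i)) * subst z (divdiff i f) = subst z f - subst (swap_at i z) f"
proof -
  let ?t = "\<lambda>\<alpha>. mmono (Poly_Mapping.lookup f \<alpha>) \<alpha>"
  have "(z i - z (Suc i)) * subst z (divdiff i f) =
     (\<Sum>\<alpha>\<in>Poly_Mapping.keys f. subst z (?t \<alpha>) - subst (swap_at i z) (?t \<alpha>))"
    by (simp add: divdiff_def subst_sum sum_distrib_left subst_dd_mono)
  also have "\<dots> = subst z f - subst (swap_at i z) f"
    by (subst (1 2) mpoly_expand[of f]) (simp add: subst_sum sum_subtractf)
  finally show ?thesis .
qed

text \<open>Holds at every point z, since composites of operators are later compared at permuted
  points. The denominator stays on the left because the target is only a ring.\<close>

lemma subst_piop:
  "(z i - z (Suc i)) * subst z (piop i f) = (1 + hbeta * z (Suc i)) * subst z f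
     - (1 + hbeta * z i) * subst (swap_at i z) f"
proof -
  have "swap_at i z (Suc i) = z i" by (simp add: swap_at_def)
  then show ?thesis by (simp add: piop_def subst_divdiff subst_mult subst_add)
qed

end

interpretation const: coeff_hom "\<lambda>c. mmono c 0"
  by unfold_locales (auto simp: mmono_def single_add mult_single)

interpretation ones: coeff_hom "\<lambda>c. c"
  by unfold_locales auto

lemma eval_ones_eq: "eval_ones f = ones.subst (\<lambda>_. 1) f"
  by (simp add: eval_ones_def ones.subst_def)

lemma hbeta_const [simp]: "const.hbeta = betaC"
  by (simp add: const.hbeta_def betaC_def)

lemma eval_ones_simps [simp]:
  "eval_ones (f + g) = eval_ones f + eval_ones g"
  "eval_ones (f * g) = eval_ones f * eval_ones g"
  "eval_ones 1 = 1"
  "eval_ones (xvar i) = 1"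
  "eval_ones betaC = [:0, 1:]"
  by (simp_all add: eval_ones_eq ones.subst_add ones.subst_mult ones.hbeta_def)

lemma mmono_prod: "finite S \<Longrightarrow> (\<Prod>i\<in>S. mmono 1 (g i)) = mmono 1 (\<Sum>i\<in>S. g i)"
  by (induction S rule: finite_induct) (auto simp: mmono_def mult_single)

lemma monom_eval_xvar: "monom_eval xvar \<alpha> = mmono 1 \<alpha>"
proof -
  have p: "xvar i ^ n = mmono 1 (Poly_Mapping.single i n)" for i n
    by (induction n) (auto simp: xvar_def mmono_def mult_single simp flip: single_add)
  have "(\<Sum>i\<in>Poly_Mapping.keys \<alpha>. Poly_Mapping.single i (Poly_Mapping.lookup \<alpha> i)) = \<alpha>"
    by (rule poly_mapping_eqI) (auto simp: lookup_sum lookup_single when_def in_keys_iff)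
  then show ?thesis by (simp add: monom_eval_def p mmono_prod)
qed

lemma subst_xvar_id [simp]: "const.subst xvar f = f"
proof -
  have "mmono c 0 * mmono 1 \<alpha> = mmono c \<alpha>" for c \<alpha> by (simp add: mmono_def mult_single)
  then show ?thesis
    unfolding const.subst_def monom_eval_xvar using mpoly_expand[of f] by simp
qed

lemma inj_xvar: "xvar i = xvar j \<longleftrightarrow> i = j"
proof
  assume "xvar i = xvar j"
  then have "Poly_Mapping.keys (xvar i) = Poly_Mapping.keys (xvar j)" by simp
  then have "Poly_Mapping.single i (1::nat) = Poly_Mapping.single j 1"
    by (simp add: xvar_def mmono_def)
  then have "Poly_Mapping.keys (Poly_Mapping.single i (1::nat)) = Poly_Mapping.keys (Poly_Mapping.single j (1::nat))"
    by simp
  then show "i = j" by simp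
qed simp

lemma xvar_diff_nz: "i \<noteq> j \<Longrightarrow> xvar i - xvar j \<noteq> 0"
  by (simp add: inj_xvar)

section \<open>Algebra of the operators \<open>piop\<close>: symmetry, product rules, commutation
  and braid relations\<close>

definition swapvar :: "nat \<Rightarrow> mpoly \<Rightarrow> mpoly" where
  "swapvar i = const.subst (swap_at i xvar)"

lemma swap_at_simps [simp]:
  "swap_at i z i = z (Suc i)" "swap_at i z (Suc i) = z i"
  "j \<noteq> i \<Longrightarrow> j \<noteq> Suc i \<Longrightarrow> swap_at i z j = z j"
  by (auto simp: swap_at_def)

lemma swap_at_swap_at [simp]: "swap_at i (swap_at i z) = z"
  by (auto simp: swap_at_def)

lemma swapvar_simps [simp]:
  "swapvar i (f + g) = swapvar i f + swapvar i g"
  "swapvar i (f * g) = swapvar i f * swapvar i g"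
  "swapvar i 1 = 1"
  "swapvar i betaC = betaC"
  "swapvar i (xvar i) = xvar (Suc i)"
  "swapvar i (xvar (Suc i)) = xvar i"
  "j \<noteq> i \<Longrightarrow> j \<noteq> Suc i \<Longrightarrow> swapvar i (xvar j) = xvar j"
  by (simp_all add: swapvar_def const.subst_add const.subst_mult)

lemma piop_key:
  "(xvar i - xvar (Suc i)) * piop i f = (1 + betaC * xvar (Suc i)) * f - (1 + betaC * xvar i) * swapvar i f"
  using const.subst_piop[of xvar i f] by (simp add: swapvar_def)

text \<open>\<open>mpoly\<close> has no zero divisors, so the product identity characterizes
  \<open>piop i f\<close>.\<close>

lemma piop_eqI:
  assumes "(xvar i - xvar (Suc i)) * g = (1 + betaC * xvar (Suc i)) * f - (1 + betaC * xvar i) * swapvar i f"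
  shows "piop i f = g"
  using assms piop_key[of i f] xvar_diff_nz[of i "Suc i"] by (metis mult_left_cancel n_not_Suc_n)

lemma swapvar_piop: "swapvar i (piop i f) = piop i f"
proof -
  have "(xvar (Suc i) - xvar i) * swapvar i (piop i f) =
      (1 + betaC * xvar i) * swapvar i f - (1 + betaC * xvar (Suc i)) * f"
    using const.subst_piop[of "swap_at i xvar" i f] by (simp add: swapvar_def)
  then have "(xvar i - xvar (Suc i)) * swapvar i (piop i f) = (xvar i - xvar (Suc i)) * piop i f"
    unfolding piop_key by (simp add: algebra_simps)
  then show ?thesis using xvar_diff_nz[of i "Suc i"] by simp
qed

lemma piop_add: "piop i (f + g) = piop i f + piop i g"
  by (rule piop_eqI) (simp only: distrib_left[of "xvar i - xvar (Suc i)"] piop_key, simp add: algebra_simps)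

lemma piop_symm: "swapvar i f = f \<Longrightarrow> piop i f = - betaC * f"
  by (rule piop_eqI) (simp add: algebra_simps)

lemma piop_piop: "piop i (piop i f) = - betaC * piop i f"
  by (simp add: piop_symm swapvar_piop)

lemma piop_mult: "swapvar i g = g \<Longrightarrow> piop i (g * f) = g * piop i f"
  by (rule piop_eqI) (simp only: mult.left_commute[of "xvar i - xvar (Suc i)"] piop_key, simp add: algebra_simps)

text \<open>The last summand vanishes whenever \<open>piop i f = - betaC * f\<close>; this is why a
  token meeting a smaller letter has no choice.\<close>

lemma piop_xvar:
  "piop i (xvar i * f) = f + xvar (Suc i) * (piop i f + betaC * f)"
  by (rule piop_eqI)
    (simp only: distrib_left[of "xvar i - xvar (Suc i)"] mult.left_commute[of "xvar i - xvar (Suc i)"]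
      piop_key, simp add: algebra_simps)

lemma piop_commute:
  assumes "Suc i < j"
  shows "piop i (piop j f) = piop j (piop i f)"
proof -
  let ?s = "const.subst"
  let ?di = "xvar i - xvar (Suc i)" and ?dj = "xvar j - xvar (Suc j)"
  let ?zi = "swap_at i xvar" and ?zj = "swap_at j xvar"
  have sw: "swap_at i ?zj = swap_at j ?zi" using assms by (auto simp: swap_at_def)
  have a: "?dj * ?s ?zi (piop j f) = (1 + betaC * xvar (Suc j)) * ?s ?zi f
      - (1 + betaC * xvar j) * ?s (swap_at j ?zi) f"
    using const.subst_piop[of ?zi j f] assms by simp
  have b: "?di * ?s ?zj (piop i f) = (1 + betaC * xvar (Suc i)) * ?s ?zj f
      - (1 + betaC * xvar i) * ?s (swap_at j ?zi) f"
    using const.subst_piop[of ?zj i f] assms by (simp add: sw)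
  have c: "?di * piop i (piop j f) = (1 + betaC * xvar (Suc i)) * piop j f - (1 + betaC * xvar i) * ?s ?zi (piop j f)"
    and d: "?dj * piop j (piop i f) = (1 + betaC * xvar (Suc j)) * piop i f - (1 + betaC * xvar j) * ?s ?zj (piop i f)"
    and e: "?di * piop i f = (1 + betaC * xvar (Suc i)) * f - (1 + betaC * xvar i) * ?s ?zi f"
    and g: "?dj * piop j f = (1 + betaC * xvar (Suc j)) * f - (1 + betaC * xvar j) * ?s ?zj f"
    using piop_key by (simp_all add: swapvar_def)
  \<comment> \<open>With both denominators cleared, either composite is a combination of f at the
    four points given by the two commuting swaps.\<close>
  have "(?di * ?dj) * piop i (piop j f) = ?dj * (?di * piop i (piop j f))"
    by (simp only: mult_ac)
  also have "\<dots> = (1 + betaC * xvar (Suc i)) * (?dj * piop j f) - (1 + betaC * xvar i) * (?dj * ?s ?zi (piop j f))"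
    unfolding c by (simp only: right_diff_distrib mult.left_commute[of ?dj])
  also have "\<dots> = (1 + betaC * xvar (Suc j)) * (?di * piop i f) - (1 + betaC * xvar j) * (?di * ?s ?zj (piop i f))"
    unfolding a b e g by (simp add: algebra_simps)
  also have "\<dots> = ?di * (?dj * piop j (piop i f))"
    unfolding d by (simp only: right_diff_distrib mult.left_commute[of ?di])
  finally have "(?di * ?dj) * piop i (piop j f) = (?di * ?dj) * piop j (piop i f)"
    by (simp only: mult_ac)
  then show ?thesis using xvar_diff_nz[of i "Suc i"] xvar_diff_nz[of j "Suc j"] by simp
qed

text \<open>The digits record the order in which a, b, c are inserted; f, h, g, r are the successive
  polynomials. Symmetry of h in its first two variables lets \<open>h123\<close> stand for its value
  at 213. The outcome is an alternating sum over all six orders.\<close>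

lemma braid_left:
  fixes a b c t :: "'a::idom"
  assumes "(a - b) * h123 = (1 + t * b) * f123 - (1 + t * a) * f213"
    and "(a - c) * h132 = (1 + t * c) * f132 - (1 + t * a) * f312"
    and "(b - c) * h231 = (1 + t * c) * f231 - (1 + t * b) * f321"
    and "(b - c) * g123 = (1 + t * c) * h123 - (1 + t * b) * h132"
    and "(a - c) * g213 = (1 + t * c) * h123 - (1 + t * a) * h231"
    and "(a - b) * r = (1 + t * b) * g123 - (1 + t * a) * g213"
  shows "((a - b) * (b - c) * (a - c)) * r =
     (1 + t * c)^2 * ((1 + t * b) * f123 - (1 + t * a) * f213)
   - (1 + t * b)^2 * ((1 + t * c) * f132 - (1 + t * a) * f312)
   + (1 + t * a)^2 * ((1 + t * c) * f231 - (1 + t * b) * f321)"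
  using assms by algebra

text \<open>The other composite: h is now symmetric in its last two variables, and the same
  alternating sum results.\<close>

lemma braid_right:
  fixes a b c t :: "'a::idom"
  assumes "(b - c) * h123 = (1 + t * c) * f123 - (1 + t * b) * f132"
    and "(a - c) * h213 = (1 + t * c) * f213 - (1 + t * a) * f231"
    and "(a - b) * h312 = (1 + t * b) * f312 - (1 + t * a) * f321"
    and "(a - b) * g123 = (1 + t * b) * h123 - (1 + t * a) * h213"
    and "(a - c) * g132 = (1 + t * c) * h123 - (1 + t * a) * h312"
    and "(b - c) * r = (1 + t * c) * g123 - (1 + t * b) * g132"
  shows "((a - b) * (b - c) * (a - c)) * r =
     (1 + t * c)^2 * ((1 + t * b) * f123 - (1 + t * a) * f213)
   - (1 + t * b)^2 * ((1 + t * c) * f132 - (1 + t * a) * f312)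
   + (1 + t * a)^2 * ((1 + t * c) * f231 - (1 + t * b) * f321)"
  using assms by algebra

lemma piop_braid:
  "piop i (piop (Suc i) (piop i f)) = piop (Suc i) (piop i (piop (Suc i) f))"
proof -
  let ?s = "const.subst" and ?j = "Suc i"
  define a b c where "a = xvar i" and "b = xvar (Suc i)" and "c = xvar (Suc (Suc i))"
  define D where "D = (a - b) * (b - c) * (a - c)"
  let ?z213 = "swap_at i xvar" and ?z132 = "swap_at ?j xvar"
  let ?z231 = "swap_at ?j ?z213" and ?z312 = "swap_at i ?z132"
  let ?z321 = "swap_at i ?z231"
  have z321: "swap_at ?j ?z312 = ?z321" by (auto simp: swap_at_def)
  have left: "D * piop i (piop ?j (piop i f)) =
     (1 + betaC * c)^2 * ((1 + betaC * b) * f - (1 + betaC * a) * ?s ?z213 f)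
   - (1 + betaC * b)^2 * ((1 + betaC * c) * ?s ?z132 f - (1 + betaC * a) * ?s ?z312 f)
   + (1 + betaC * a)^2 * ((1 + betaC * c) * ?s ?z231 f - (1 + betaC * b) * ?s ?z321 f)"
    unfolding D_def
  proof (rule braid_left)
    let ?h = "piop i f"
    let ?g = "piop ?j ?h"
    show "(a - b) * ?h = (1 + betaC * b) * f - (1 + betaC * a) * ?s ?z213 f"
      using const.subst_piop[of xvar i f] by (simp add: a_def b_def)
    show "(a - c) * ?s ?z132 ?h = (1 + betaC * c) * ?s ?z132 f - (1 + betaC * a) * ?s ?z312 f"
      using const.subst_piop[of ?z132 i f] by (simp add: a_def c_def)
    show "(b - c) * ?s ?z231 ?h = (1 + betaC * c) * ?s ?z231 f - (1 + betaC * b) * ?s ?z321 f"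
      using const.subst_piop[of ?z231 i f] by (simp add: b_def c_def)
    show "(b - c) * ?g = (1 + betaC * c) * ?h - (1 + betaC * b) * ?s ?z132 ?h"
      using const.subst_piop[of xvar ?j ?h] by (simp add: b_def c_def)
    show "(a - c) * ?s ?z213 ?g = (1 + betaC * c) * ?h - (1 + betaC * a) * ?s ?z231 ?h"
      using const.subst_piop[of ?z213 ?j ?h] swapvar_piop[of i f] by (simp add: a_def c_def swapvar_def)
    show "(a - b) * piop i ?g = (1 + betaC * b) * ?g - (1 + betaC * a) * ?s ?z213 ?g"
      using const.subst_piop[of xvar i ?g] by (simp add: a_def b_def)
  qed
  have right: "D * piop ?j (piop i (piop ?j f)) =
     (1 + betaC * c)^2 * ((1 + betaC * b) * f - (1 + betaC * a) * ?s ?z213 f)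
   - (1 + betaC * b)^2 * ((1 + betaC * c) * ?s ?z132 f - (1 + betaC * a) * ?s ?z312 f)
   + (1 + betaC * a)^2 * ((1 + betaC * c) * ?s ?z231 f - (1 + betaC * b) * ?s ?z321 f)"
    unfolding D_def
  proof (rule braid_right)
    let ?h = "piop ?j f"
    let ?g = "piop i ?h"
    show "(b - c) * ?h = (1 + betaC * c) * f - (1 + betaC * b) * ?s ?z132 f"
      using const.subst_piop[of xvar ?j f] by (simp add: b_def c_def)
    show "(a - c) * ?s ?z213 ?h = (1 + betaC * c) * ?s ?z213 f - (1 + betaC * a) * ?s ?z231 f"
      using const.subst_piop[of ?z213 ?j f] by (simp add: a_def c_def)
    show "(a - b) * ?s ?z312 ?h = (1 + betaC * b) * ?s ?z312 f - (1 + betaC * a) * ?s ?z321 f"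
      using const.subst_piop[of ?z312 ?j f] by (simp add: a_def b_def z321)
    show "(a - b) * ?g = (1 + betaC * b) * ?h - (1 + betaC * a) * ?s ?z213 ?h"
      using const.subst_piop[of xvar i ?h] by (simp add: a_def b_def)
    show "(a - c) * ?s ?z132 ?g = (1 + betaC * c) * ?h - (1 + betaC * a) * ?s ?z312 ?h"
      using const.subst_piop[of ?z132 i ?h] swapvar_piop[of ?j f] by (simp add: a_def c_def swapvar_def)
    show "(b - c) * piop ?j ?g = (1 + betaC * c) * ?g - (1 + betaC * b) * ?s ?z132 ?g"
      using const.subst_piop[of xvar ?j ?g] by (simp add: b_def c_def)
  qed
  have "D \<noteq> 0" by (simp add: D_def a_def b_def c_def inj_xvar)
  with left right show ?thesis by (metis mult_left_cancel)
qed

section \<open>Grothendieck polynomials by removing the smallest letter\<close>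

text \<open>The factor gained by the monomial \<open>groth_top\<close> when a new smallest letter is
  appended to a decreasing word.\<close>

definition xprod :: "nat \<Rightarrow> mpoly" where
  "xprod n = (\<Prod>j\<in>{1..<n}. xvar j)"

lemma xprod_Suc: "1 \<le> n \<Longrightarrow> xprod (Suc n) = xprod n * xvar n"
  by (simp add: xprod_def mult.commute)

lemma swapvar_prod: "swapvar i (\<Prod>j\<in>S. f j) = (\<Prod>j\<in>S. swapvar i (f j))"
  by (induction S rule: infinite_finite_induct) auto

lemma swapvar_xprod_out: "n \<le> i \<Longrightarrow> swapvar i (xprod n) = xprod n"
  unfolding xprod_def swapvar_prod by (rule prod.cong) auto

lemma swapvar_xprod_in:
  assumes "1 \<le> i" "Suc i < n"
  shows "swapvar i (xprod n) = xprod n"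
proof -
  let ?S = "{1..<n} - {i, Suc i}"
  have eq: "{1..<n} = insert i (insert (Suc i) ?S)" using assms by auto
  have p: "(\<Prod>j\<in>{1..<n}. g j) = g i * (g (Suc i) * (\<Prod>j\<in>?S. g j))" for g :: "nat \<Rightarrow> mpoly"
    by (subst eq) simp
  have rest: "swapvar i (\<Prod>j\<in>?S. xvar j) = (\<Prod>j\<in>?S. xvar j)"
    unfolding swapvar_prod by (rule prod.cong) auto
  show ?thesis unfolding xprod_def p swapvar_simps rest by (simp only: mult.left_commute)
qed

lemma piop_far_commute: "Suc i < j \<or> Suc j < i \<Longrightarrow> piop i (piop j f) = piop j (piop i f)"
  using piop_commute by metis

lemma piop_chain_commute:
  "\<forall>j\<in>set js. Suc i < j \<or> Suc j < i \<Longrightarrow> foldr piop js (piop i f) = piop i (foldr piop js f)"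
  by (induction js) (auto simp: piop_far_commute)

text \<open>The inner operator commutes with the factors of index above i + 1, one braid move turns
  it into the operator of index i + 1, and that commutes with the factors of index below i.\<close>

lemma piop_chain_shift:
  assumes "p \<le> i" "Suc i < n"
  shows "foldr piop [p..<n] (piop i f) = piop (Suc i) (foldr piop [p..<n] f)"
proof -
  have u: "[p..<n] = [p..<i] @ i # Suc i # [Suc (Suc i)..<n]"
    using upt_add_eq_append[of p i "n - i"] assms by (simp add: upt_conv_Cons)
  let ?g = "foldr piop [Suc (Suc i)..<n] f"
  have "foldr piop [Suc (Suc i)..<n] (piop i f) = piop i ?g"
    by (rule piop_chain_commute) auto
  moreover have "foldr piop [p..<i] (piop (Suc i) h) = piop (Suc i) (foldr piop [p..<i] h)" for h
    by (rule piop_chain_commute) auto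
  ultimately show ?thesis by (simp add: u piop_braid)
qed

text \<open>Moving the smallest letter to the end of the word costs the chain of operators; a smallest
  letter in last position contributes the monomial.\<close>
function hgroth :: "nat list \<Rightarrow> mpoly" where
  "hgroth w = (if w = [] then 1 else
     let m = Min (set w); p = length (takeWhile (\<lambda>x. x \<noteq> m) w)
     in foldr piop [Suc p..<length w] (xprod (length w) * hgroth (remove1 m w)))"
  by auto
termination
  by (relation "measure length") (auto simp: length_remove1)

declare hgroth.simps [simp del]

lemma hgroth_Nil [simp]: "hgroth [] = 1"
  by (simp add: hgroth.simps)

lemma hgroth_split:
  assumes "\<forall>x\<in>set L \<union> set R. m < x"
  shows "hgroth (L @ m # R) = foldr piop [Suc (length L)..<Suc (length L + length R)]
           (xprod (Suc (length L + length R)) * hgroth (L @ R))"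
proof -
  have m: "Min (set (L @ m # R)) = m"
    using assms by (intro Min_eqI) (auto intro: less_imp_le)
  have "m \<notin> set L" using assms by auto
  then have "takeWhile (\<lambda>x. x \<noteq> m) (L @ m # R) = L" "remove1 m (L @ m # R) = L @ R"
    by (auto simp: takeWhile_tail remove1_append takeWhile_append2)
  with m show ?thesis by (subst hgroth.simps) (simp add: Let_def)
qed

lemma split_Min:
  fixes w :: "nat list"
  assumes "distinct w" "w \<noteq> []"
  obtains L m R where "w = L @ m # R" "\<forall>x\<in>set L \<union> set R. m < x"
proof -
  have "Min (set w) \<in> set w" using assms by simp
  then obtain L R where w: "w = L @ Min (set w) # R" by (meson split_list)
  have "\<forall>x\<in>set L \<union> set R. Min (set w) < x"
  proof
    fix x assume x: "x \<in> set L \<union> set R"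
    have "x \<noteq> Min (set w)" using assms(1) w x 
      by (metis Un_iff distinct_append distinct.simps(2) not_distinct_conv_prefix)
    moreover have "x \<in> set w" using x by (subst w) auto
    ultimately show "Min (set w) < x" by (metis List.finite_set Min_le order_le_neq_trans)
  qed
  with w that show thesis by metis
qed

text \<open>The defining recursion, at an arbitrary ascent. Induction removes the smallest letter m.
  If m is x, the two chains differ by exactly the operator in question; if m is in u, the braid
  shift accounts for positions moving by one; if m is in v, the operators commute.\<close>

lemma hgroth_ascent:
  "distinct (u @ x # y # v) \<Longrightarrow> x < y \<Longrightarrow>
    hgroth (u @ x # y # v) = piop (Suc (length u)) (hgroth (u @ y # x # v))"
proof (induction "length u + length v" arbitrary: u v rule: less_induct)
  case less
  let ?w = "u @ x # y # v"
  obtain L m R where w: "?w = L @ m # R" and m: "\<forall>z\<in>set L \<union> set R. m < z"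
    using less.prems split_Min by (metis append_is_Nil_conv list.discI)
  have "m \<in> set ?w" unfolding w by simp
  moreover have "\<forall>z\<in>set ?w. m \<le> z" unfolding w using m by (auto intro: less_imp_le)
  ultimately have mm: "m \<in> set ?w" "\<forall>z\<in>set ?w. m \<le> z" by auto
  then consider "m = x" | "m \<in> set u" | "m \<in> set v" using less.prems by fastforce
  then show ?case
  proof cases
    case 1
    then have c: "\<forall>z\<in>set u \<union> set (y # v). x < z" "\<forall>z\<in>set (u @ [y]) \<union> set v. x < z"
      using mm less.prems by (auto simp: order.strict_iff_order)
    show ?thesis
      using hgroth_split[OF c(1)] hgroth_split[OF c(2)] 1 by (simp add: upt_conv_Cons del: upt_Suc)
  next
    case 2
    then obtain u1 u2 where u: "u = u1 @ m # u2" by (meson split_list)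
    have c: "\<forall>z\<in>set u1 \<union> set (u2 @ x # y # v). m < z" "\<forall>z\<in>set u1 \<union> set (u2 @ y # x # v). m < z"
      using mm less.prems by (auto simp: order.strict_iff_order u)
    define i n where "i = Suc (length u1 + length u2)" and "n = Suc (length u1 + length (u2 @ x # y # v))"
    have "hgroth ((u1 @ u2) @ x # y # v) = piop (Suc (length (u1 @ u2))) (hgroth ((u1 @ u2) @ y # x # v))"
      by (rule less.hyps) (use less.prems u in auto)
    then have IH: "hgroth (u1 @ u2 @ x # y # v) = piop i (hgroth (u1 @ u2 @ y # x # v))"
      by (simp add: i_def)
    have "swapvar i (xprod n) = xprod n" by (rule swapvar_xprod_in) (auto simp: i_def n_def)
    then have "xprod n * piop i h = piop i (xprod n * h)" for h by (simp add: piop_mult)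
    moreover have "foldr piop [Suc (length u1)..<n] (piop i h) = piop (Suc i) (foldr piop [Suc (length u1)..<n] h)" for h
      by (rule piop_chain_shift) (auto simp: i_def n_def)
    moreover have "hgroth ?w = foldr piop [Suc (length u1)..<n] (xprod n * hgroth (u1 @ u2 @ x # y # v))"
      using hgroth_split[OF c(1)] by (simp add: u n_def del: upt_Suc)
    ultimately have "hgroth ?w = piop (Suc i) (foldr piop [Suc (length u1)..<n] (xprod n * hgroth (u1 @ u2 @ y # x # v)))"
      by (simp only: IH)
    then show ?thesis using hgroth_split[OF c(2)] by (simp add: u i_def n_def del: upt_Suc)
  next
    case 3
    then obtain v1 v2 where v: "v = v1 @ m # v2" by (meson split_list)
    have c: "\<forall>z\<in>set (u @ x # y # v1) \<union> set v2. m < z" "\<forall>z\<in>set (u @ y # x # v1) \<union> set v2. m < z"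
      using mm less.prems by (auto simp: order.strict_iff_order v)
    define i p n where "i = Suc (length u)" and "p = Suc (length (u @ x # y # v1))"
      and "n = Suc (length (u @ x # y # v1) + length v2)"
    have IH: "hgroth (u @ x # y # v1 @ v2) = piop i (hgroth (u @ y # x # v1 @ v2))"
      unfolding i_def by (rule less.hyps) (use less.prems v in auto)
    have "swapvar i (xprod n) = xprod n" by (rule swapvar_xprod_in) (auto simp: i_def n_def)
    then have "xprod n * piop i h = piop i (xprod n * h)" for h by (simp add: piop_mult)
    moreover have "foldr piop [p..<n] (piop i h) = piop i (foldr piop [p..<n] h)" for h
      by (rule piop_chain_commute) (auto simp: p_def i_def)
    ultimately have "hgroth ?w = piop i (foldr piop [p..<n] (xprod n * hgroth (u @ y # x # v1 @ v2)))"
      using hgroth_split[OF c(1)] IH by (simp add: v p_def n_def del: upt_Suc)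
    then show ?thesis using hgroth_split[OF c(2)] by (simp add: v i_def p_def n_def del: upt_Suc)
  qed
qed

section \<open>Token operators and the recursion for values at ones\<close>

lemma piop_hgroth_ascent:
  "distinct (u @ x # y # v) \<Longrightarrow> x < y \<Longrightarrow>
    piop (Suc (length u)) (hgroth (u @ x # y # v)) = - betaC * hgroth (u @ x # y # v)"
  by (simp add: hgroth_ascent piop_piop)

definition epsop :: "nat \<Rightarrow> mpoly \<Rightarrow> mpoly" where
  "epsop j f = piop j (xvar j * f)"

text \<open>The product x_1 ... x_(n-1) is invariant under the nth swap, so each operator consumes
  only its own variable and the rest moves out.\<close>

lemma xprod_chain:
  assumes "1 \<le> p" "p \<le> n"
  shows "foldr piop [p..<n] (xprod n * f) = xprod p * foldr epsop [p..<n] f"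
  using assms(2)
proof (induction n arbitrary: f rule: dec_induct)
  case (step n)
  have "piop n (xprod (Suc n) * f) = xprod n * epsop n f"
    using step assms by (simp add: xprod_Suc mult.assoc epsop_def piop_mult swapvar_xprod_out)
  then show ?case using step by simp
qed simp

text \<open>By \<open>symm\<close> and \<open>piop_xvar\<close>, the last operator of the chain
  merely removes its variable. Hence the chain is one operator shorter than in
  \<open>hgroth_split\<close>.\<close>

lemma hgroth_split_eps:
  assumes "\<forall>x\<in>set L \<union> set R. m < x"
    and symm: "R \<noteq> [] \<Longrightarrow> piop (length L + length R) (hgroth (L @ R)) = - betaC * hgroth (L @ R)"
  shows "hgroth (L @ m # R) = xprod (Suc (length L)) *
           foldr epsop [Suc (length L)..<length L + length R] (hgroth (L @ R))"
proof (cases "R = []")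
  case True
  then show ?thesis using hgroth_split[OF assms(1)] by simp
next
  case False
  define p N where "p = Suc (length L)" and "N = length L + length R"
  have pN: "1 \<le> p" "p \<le> N" "1 \<le> N" using False by (auto simp: p_def N_def Suc_le_eq)
  have "piop N (xprod (Suc N) * hgroth (L @ R)) = xprod N * hgroth (L @ R)"
    using pN symm[OF False] by (simp add: xprod_Suc mult.assoc piop_mult swapvar_xprod_out piop_xvar N_def)
  then have "hgroth (L @ m # R) = foldr piop [p..<N] (xprod N * hgroth (L @ R))"
    using hgroth_split[OF assms(1)] pN by (simp add: p_def N_def)
  then show ?thesis using xprod_chain[OF pN(1,2)] by (simp add: p_def N_def)
qed

lemma epsop_mult: "swapvar j g = g \<Longrightarrow> epsop j (g * f) = g * epsop j f"
  by (simp add: epsop_def mult.left_commute[of "xvar j"] piop_mult)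

lemma epsop_add: "epsop j (f + g) = epsop j f + epsop j g"
  by (simp add: epsop_def distrib_left piop_add)

lemma epsop_chain_add: "foldr epsop js (f + g) = foldr epsop js f + foldr epsop js g"
  by (induction js) (auto simp: epsop_add)

lemma epsop_chain_mult:
  "\<forall>j\<in>set js. swapvar j g = g \<Longrightarrow> foldr epsop js (g * f) = g * foldr epsop js f"
  by (induction js) (auto simp: epsop_mult)

lemma piop_epsop_chain:
  "\<forall>j\<in>set js. Suc j < k \<Longrightarrow> piop k (foldr epsop js f) = foldr epsop js (piop k f)"
proof (induction js)
  case (Cons j js)
  have "piop k (epsop j h) = epsop j (piop k h)" for h
    using Cons.prems by (simp add: epsop_def piop_far_commute[of k j] piop_mult)
  with Cons show ?case by simp
qed simp

lemma swapvar_uminus_betaC [simp]: "swapvar i (- betaC) = - betaC"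
  by (simp add: swapvar_def const.subst_uminus)

text \<open>The eigenvalue equation is symmetry in x_k and x_(k+1) in disguise; a word of length n
  uses only the variables x_1, ..., x_(n-1). The induction hypothesis supplies the assumption of
  \<open>hgroth_split_eps\<close>.\<close>

lemma hgroth_symmetric:
  "distinct v \<Longrightarrow> length v \<le> k \<Longrightarrow> 1 \<le> k \<Longrightarrow> piop k (hgroth v) = - betaC * hgroth v"
proof (induction "length v" arbitrary: v k rule: less_induct)
  case less
  show ?case
  proof (cases "v = []")
    case True
    then show ?thesis by (simp add: piop_symm)
  next
    case False
    obtain L m R where v: "v = L @ m # R" and m: "\<forall>x\<in>set L \<union> set R. m < x"
      using split_Min[OF less.prems(1) False] by metis
    let ?h = "hgroth (L @ R)"
    let ?js = "[Suc (length L)..<length L + length R]"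
    have IH: "length (L @ R) \<le> k \<Longrightarrow> 1 \<le> k \<Longrightarrow> piop k ?h = - betaC * ?h" for k
      by (rule less.hyps) (use less.prems v in auto)
    have eq: "hgroth v = xprod (Suc (length L)) * foldr epsop ?js ?h"
      unfolding v by (rule hgroth_split_eps[OF m]) (rule IH, auto simp: Suc_le_eq)
    have kh: "piop k ?h = - betaC * ?h" using less.prems by (intro IH) (auto simp: v)
    have "piop k (foldr epsop ?js ?h) = foldr epsop ?js (piop k ?h)"
      by (rule piop_epsop_chain) (use less.prems v in auto)
    also have "\<dots> = - betaC * foldr epsop ?js ?h"
      unfolding kh by (rule epsop_chain_mult) simp
    finally show ?thesis
      using less.prems unfolding eq
      by (subst piop_mult) (auto simp: v intro: swapvar_xprod_out)
  qed
qed

text \<open>The unread letters, last one first, are in \<open>Y\<close>; the token is the head of \<open>D\<close>, and the rest of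
  \<open>D\<close> is final. The empty \<open>D\<close> only occurs before the first letter is read.\<close>
primrec tau :: "(nat list \<Rightarrow> int poly) \<Rightarrow> nat list \<Rightarrow> nat list \<Rightarrow> int poly" where
  "tau \<phi> [] D = \<phi> D"
| "tau \<phi> (y # Y) D = (case D of [] \<Rightarrow> tau \<phi> Y [y]
     | x # E \<Rightarrow> if y < x then tau \<phi> Y (y # x # E)
                else [:1, 1:] * tau \<phi> Y (y # x # E) + tau \<phi> Y (x # y # E))"

text \<open>One move of the token x at the letter y. At an ascent \<open>hgroth\<close> is an
  eigenvector and the word stays; at a descent \<open>piop\<close> produces the swapped word, in
  which x has jumped.\<close>

lemma epsop_hgroth:
  assumes "distinct (u @ y # x # v)"
  shows "epsop (Suc (length u)) (hgroth (u @ y # x # v)) =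
    (if y < x then hgroth (u @ y # x # v)
     else (1 + betaC * xvar (Suc (Suc (length u)))) * hgroth (u @ y # x # v)
        + xvar (Suc (Suc (length u))) * hgroth (u @ x # y # v))"
proof (cases "y < x")
  case True
  then show ?thesis using piop_hgroth_ascent[OF assms] by (simp add: epsop_def piop_xvar)
next
  case False
  then have "piop (Suc (length u)) (hgroth (u @ y # x # v)) = hgroth (u @ x # y # v)"
    using assms by (subst hgroth_ascent) auto
  then show ?thesis using False by (simp add: epsop_def piop_xvar algebra_simps)
qed

lemma eval_ones_epsop_chain:
  "distinct (L @ rev Y @ x # S) \<Longrightarrow>
   eval_ones (foldr epsop [Suc (length L)..<Suc (length L + length Y)] (hgroth (L @ rev Y @ x # S)))
     = tau (\<lambda>R. eval_ones (hgroth (L @ R))) Y (x # S)"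
proof (induction Y arbitrary: x S)
  case (Cons y Y)
  define js where "js = [Suc (length L)..<Suc (length L + length Y)]"
  define X where "X = xvar (Suc (Suc (length L + length Y)))"
  \<comment> \<open>The operators still to be applied touch variables only up to the index just
    below that of X, so the weight leaves the chain and can be set to 1.\<close>
  have X: "swapvar j X = X" if "j \<in> set js" for j using that by (auto simp: js_def X_def)
  have js: "[Suc (length L)..<Suc (length L + length (y # Y))] = js @ [Suc (length L + length Y)]"
    by (simp add: js_def)
  have eps: "epsop (Suc (length L + length Y)) (hgroth (L @ rev Y @ y # x # S)) =
    (if y < x then hgroth (L @ rev Y @ y # x # S)
     else (1 + betaC * X) * hgroth (L @ rev Y @ y # x # S) + X * hgroth (L @ rev Y @ x # y # S))"
    using epsop_hgroth[of "L @ rev Y" y x S] Cons.prems by (simp add: X_def)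
  have IH: "eval_ones (foldr epsop js (hgroth (L @ rev Y @ y # x # S))) =
        tau (\<lambda>R. eval_ones (hgroth (L @ R))) Y (y # x # S)"
      "eval_ones (foldr epsop js (hgroth (L @ rev Y @ x # y # S))) =
        tau (\<lambda>R. eval_ones (hgroth (L @ R))) Y (x # y # S)"
    unfolding js_def by (rule Cons.IH; use Cons.prems in auto)+
  have X1: "eval_ones X = 1" by (simp add: X_def)
  show ?case
    unfolding js by (simp add: eps epsop_chain_add epsop_chain_mult X IH X1 one_pCons)
qed simp

definition ups :: "nat list \<Rightarrow> int poly" where
  "ups w = eval_ones (hgroth w)"

theorem ups_split:
  assumes "distinct (L @ m # R)" "\<forall>x\<in>set L \<union> set R. m < x"
  shows "ups (L @ m # R) = tau (\<lambda>R'. ups (L @ R')) (rev R) []"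
proof -
  have eq: "hgroth (L @ m # R) = xprod (Suc (length L)) *
     foldr epsop [Suc (length L)..<length L + length R] (hgroth (L @ R))"
    by (rule hgroth_split_eps[OF assms(2)], rule hgroth_symmetric) (use assms in \<open>auto simp: Suc_le_eq\<close>)
  have "eval_ones (xprod n) = 1" for n
    by (simp add: xprod_def eval_ones_eq ones.subst_prod)
  then have "ups (L @ m # R) =
      eval_ones (foldr epsop [Suc (length L)..<length L + length R] (hgroth (L @ R)))"
    by (simp add: ups_def eq)
  also have "\<dots> = tau (\<lambda>R'. ups (L @ R')) (rev R) []"
  \<comment> \<open>The last letter of R is the first token, which matches a chain of |R| - 1
    operators.\<close>
  proof (cases R rule: rev_cases)
    case (snoc R0 x)
    then show ?thesis
      using eval_ones_epsop_chain[of L "rev R0" x "[]"] assms(1) by (simp add: ups_def)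
  qed (simp add: ups_def)
  finally show ?thesis .
qed

section \<open>Agreement with the definition by least ascents\<close>

lemma groth_top_Suc: "groth_top (Suc n) = xprod (Suc n) * groth_top n"
proof (cases n)
  case (Suc m)
  have x: "xprod k = mmono 1 (\<Sum>i\<in>{1..<k}. Poly_Mapping.single i 1)" for k
    by (simp add: xprod_def xvar_def mmono_prod)
  have "(\<Sum>i\<in>{1..<Suc n}. Poly_Mapping.single i (Suc n - i)) =
      (\<Sum>i\<in>{1..<Suc n}. Poly_Mapping.single i 1 + Poly_Mapping.single i (n - i))"
    by (rule sum.cong) (auto simp: Suc_diff_le simp flip: single_add)
  also have "\<dots> = (\<Sum>i\<in>{1..<Suc n}. Poly_Mapping.single i 1) + (\<Sum>i\<in>{1..<n}. Poly_Mapping.single i (n - i))"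
    using Suc by (simp add: sum.distrib)
  finally show ?thesis by (simp add: groth_top_def x mmono_def mult_single)
qed (simp add: groth_top_def xprod_def mmono_def)

lemma hgroth_decreasing: "sorted_wrt (>) w \<Longrightarrow> hgroth w = groth_top (length w)"
proof (induction w rule: rev_induct)
  case Nil
  show ?case by (simp add: groth_top_def mmono_def)
next
  case (snoc m L)
  have "hgroth (L @ m # []) = xprod (Suc (length L)) * hgroth L"
    using snoc.prems by (subst hgroth_split) (auto simp: sorted_wrt_append)
  with snoc show ?case by (simp add: sorted_wrt_append groth_top_Suc)
qed

lemma hgroth_map:
  "distinct w \<Longrightarrow> strict_mono_on (set w) f \<Longrightarrow> hgroth (map f w) = hgroth w"
proof (induction "length w" arbitrary: w rule: less_induct)
  case less
  show ?case
  proof (cases "w = []")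
    case False
    obtain L m R where w: "w = L @ m # R" and m: "\<forall>x\<in>set L \<union> set R. m < x"
      using split_Min[OF less.prems(1) False] by metis
    have fm: "\<forall>x\<in>set (map f L) \<union> set (map f R). f m < x"
      using m less.prems(2) by (auto simp: w strict_mono_on_def)
    have "hgroth (map f (L @ R)) = hgroth (L @ R)"
      by (rule less.hyps) (use less.prems w in \<open>auto simp: strict_mono_on_def\<close>)
    then show ?thesis using hgroth_split[OF m] hgroth_split[OF fm] by (simp add: w del: upt_Suc)
  qed simp
qed

text \<open>Non-inversions: each step of the recursion removes one, so they bound the fuel that is
  needed.\<close>

primrec ninv :: "nat list \<Rightarrow> nat" where
  "ninv [] = 0"
| "ninv (x # w) = length (filter (\<lambda>y. x < y) w) + ninv w"

lemma ninv_swap: "x < y \<Longrightarrow> ninv (u @ x # y # v) = Suc (ninv (u @ y # x # v))"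
  by (induction u) auto

lemma ninv_le: "ninv w \<le> length w ^ 2"
proof (induction w)
  case (Cons x w)
  have "ninv (x # w) \<le> length w + length w ^ 2"
    using add_mono[OF length_filter_le Cons.IH] by simp
  also have "\<dots> \<le> length (x # w) ^ 2" by (simp add: power2_eq_square)
  finally show ?case .
qed simp

lemma decreasing_perm:
  assumes "is_perm w" "\<And>i. 0 < i \<Longrightarrow> i < length w \<Longrightarrow> \<not> w ! (i - 1) < w ! i"
  shows "w = rev [1..<Suc (length w)]"
proof -
  have "sorted (rev w)"
  proof -
    have "sorted_wrt (\<ge>) w"
    proof (subst sorted_wrt_iff_nth_Suc_transp)
      show "transp (\<lambda>x y :: nat. y \<le> x)" by (auto intro: transpI)
      show "\<forall>i. Suc i < length w \<longrightarrow> w ! Suc i \<le> w ! i"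
        by (metis assms(2) diff_Suc_1 not_less zero_less_Suc)
    qed
    then show ?thesis by (simp add: sorted_wrt_rev)
  qed
  moreover have "distinct (rev w)"
    using assms(1) by (simp add: is_perm_def)
  moreover have "set (rev w) = set [1..<Suc (length w)]"
    using assms(1) unfolding is_perm_def set_rev set_upt atLeastLessThanSuc_atLeastAtMost by (rule conjunct2)
  ultimately have "rev w = [1..<Suc (length w)]"
    by (intro sorted_distinct_set_unique sorted_upt distinct_upt)
  then show ?thesis by (metis rev_rev_ident)
qed

lemma decreasing_rev_upt: "sorted_wrt (>) (rev [a..<b])"
  by (simp add: sorted_wrt_rev)

text \<open>With this much fuel the decreasing word is reached in time; \<open>hgroth_ascent\<close>
  covers the least ascent among all others.\<close>

lemma groth_aux_eq:
  "is_perm w \<Longrightarrow> ninv w \<le> k \<Longrightarrow> groth_aux k w = hgroth w"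
proof (induction k arbitrary: w)
  case (0 w)
  have "w = rev [1..<Suc (length w)]"
  proof (rule decreasing_perm[OF 0(1)])
    fix i assume i: "0 < i" "i < length w"
    show "\<not> w ! (i - 1) < w ! i"
    proof
      assume "w ! (i - 1) < w ! i"
      moreover have "w = take (i - 1) w @ w ! (i - 1) # w ! i # drop (Suc i) w"
        using i by (metis One_nat_def Suc_pred Cons_nth_drop_Suc append_take_drop_id less_imp_diff_less)
      ultimately have "0 < ninv w" by (metis ninv_swap zero_less_Suc)
      with 0(2) show False by simp
    qed
  qed
  then have "sorted_wrt (>) w" by (metis decreasing_rev_upt)
  then show ?case by (simp add: hgroth_decreasing)
next
  case (Suc k w)
  show ?case
  proof (cases "w = rev [1..<Suc (length w)]")
    case True
    then have "sorted_wrt (>) w" by (metis decreasing_rev_upt)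
    moreover have "groth_aux (Suc k) w = groth_top (length w)"
      unfolding groth_aux.simps by (rule if_P[OF True])
    ultimately show ?thesis by (simp add: hgroth_decreasing)
  next
    case False
    define i where "i = (LEAST i. 0 < i \<and> i < length w \<and> w ! (i - 1) < w ! i)"
    have "\<exists>i. 0 < i \<and> i < length w \<and> w ! (i - 1) < w ! i"
      using False decreasing_perm[OF Suc.prems(1)] by metis
    then have i: "0 < i" "i < length w" "w ! (i - 1) < w ! i"
      unfolding i_def by (metis (mono_tags, lifting) LeastI_ex)+
    define u x y v where "u = take (i - 1) w" and "x = w ! (i - 1)" and "y = w ! i" and "v = drop (Suc i) w"
    have w: "w = u @ x # y # v" unfolding u_def x_def y_def v_def
      using i by (metis One_nat_def Suc_pred Cons_nth_drop_Suc append_take_drop_id less_imp_diff_less)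
    have iu: "i = Suc (length u)" using i by (simp add: u_def)
    have sw: "swap_adj w i = u @ y # x # v"
      by (simp add: swap_adj_def w iu list_update_append nth_append)
    have xy: "x < y" using i by (simp add: x_def y_def)
    have d: "distinct w" using Suc.prems by (simp add: is_perm_def)
    have "groth_aux k (u @ y # x # v) = hgroth (u @ y # x # v)"
    proof (rule Suc.IH)
      have "set (u @ y # x # v) = set w" "length (u @ y # x # v) = length w" by (auto simp: w)
      moreover have "distinct (u @ y # x # v)" using d unfolding w by auto
      ultimately show "is_perm (u @ y # x # v)" using Suc.prems(1) unfolding is_perm_def by metis
      show "ninv (u @ y # x # v) \<le> k" using Suc.prems(2) ninv_swap[OF xy, of u v] by (simp add: w)
    qed
    moreover have "groth_aux (Suc k) w = piop i (groth_aux k (swap_adj w i))"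
      using False by (simp add: i_def Let_def del: upt_Suc)
    ultimately have "groth_aux (Suc k) w = piop i (hgroth (u @ y # x # v))"
      by (simp only: sw)
    moreover have "hgroth w = piop i (hgroth (u @ y # x # v))"
      using d unfolding w iu by (intro hgroth_ascent xy)
    ultimately show ?thesis by simp
  qed
qed

lemma strict_mono_on_rank: "strict_mono_on (set v) (\<lambda>x::nat. card {y \<in> set v. y \<le> x})"
proof (rule strict_mono_onI)
  fix r s assume rs: "r \<in> set v" "s \<in> set v" "r < s"
  then have "{y \<in> set v. y \<le> r} \<subseteq> {y \<in> set v. y \<le> s}" by auto
  moreover have "s \<in> {y \<in> set v. y \<le> s}" "s \<notin> {y \<in> set v. y \<le> r}" using rs by auto
  ultimately have "{y \<in> set v. y \<le> r} \<subset> {y \<in> set v. y \<le> s}" by blast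
  then show "card {y \<in> set v. y \<le> r} < card {y \<in> set v. y \<le> s}"
    by (intro psubset_card_mono) auto
qed

lemma is_perm_std:
  assumes "distinct v"
  shows "is_perm (std v)"
proof -
  let ?r = "\<lambda>x. card {y \<in> set v. y \<le> x}"
  have inj: "inj_on ?r (set v)" by (rule strict_mono_on_imp_inj_on[OF strict_mono_on_rank])
  have "?r ` set v \<subseteq> {1..length v}"
  proof
    fix n assume "n \<in> ?r ` set v"
    then obtain x where x: "x \<in> set v" "n = ?r x" by auto
    have "?r x \<le> card (set v)" by (rule card_mono) auto
    moreover have "0 < ?r x" using x by (subst card_gt_0_iff) auto
    ultimately show "n \<in> {1..length v}" using x distinct_card[OF assms] by auto
  qed
  moreover have "card (?r ` set v) = card {1..length v}"
    using card_image[OF inj] distinct_card[OF assms] by simp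
  ultimately have "?r ` set v = {1..length v}" by (intro card_subset_eq) auto
  with inj assms show ?thesis by (simp add: is_perm_def std_def distinct_map)
qed

text \<open>Allows words over arbitrary distinct letters, so that deletions need no
  relabelling.\<close>

lemma Upsilon_std:
  assumes "distinct v"
  shows "Upsilon (std v) = ups v"
proof -
  have "groth (std v) = hgroth (std v)"
    unfolding groth_def by (rule groth_aux_eq[OF is_perm_std[OF assms] ninv_le])
  also have "\<dots> = hgroth v"
    unfolding std_def by (rule hgroth_map[OF assms strict_mono_on_rank])
  finally show ?thesis by (simp add: Upsilon_def ups_def)
qed

section \<open>Alternating sums over subwords\<close>

lemma subseq_set: "subseq s l \<Longrightarrow> x \<in> set s \<Longrightarrow> x \<in> set l"
  by (auto simp: subseq_conv_nths dest: in_set_nthsD)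

lemma subseq_distinct: "subseq s l \<Longrightarrow> distinct l \<Longrightarrow> distinct s"
  by (auto simp: subseq_conv_nths intro: distinct_nthsI)

text \<open>Treating the letters one at a time lets the sum split along concatenations;
  \<open>altsum_eq_sum\<close> recovers the signed sum over subwords.\<close>

primrec altsum :: "nat set \<Rightarrow> nat list \<Rightarrow> (nat list \<Rightarrow> int poly) \<Rightarrow> int poly" where
  "altsum A [] \<phi> = \<phi> []"
| "altsum A (x # l) \<phi> = altsum A l (\<lambda>s. \<phi> (x # s)) - (if x \<in> A then altsum A l \<phi> else 0)"

lemma altsum_cong:
  "(\<And>s. subseq s l \<Longrightarrow> \<phi> s = \<psi> s) \<Longrightarrow> altsum A l \<phi> = altsum A l \<psi>"
proof (induction l arbitrary: \<phi> \<psi>)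
  case (Cons x l)
  have "altsum A l (\<lambda>s. \<phi> (x # s)) = altsum A l (\<lambda>s. \<psi> (x # s))"
    by (rule Cons.IH) (auto intro: Cons.prems)
  moreover have "altsum A l \<phi> = altsum A l \<psi>"
    by (rule Cons.IH) (auto intro: Cons.prems)
  ultimately show ?case by simp
qed auto

lemma altsum_cong_set:
  "A \<inter> set l = B \<inter> set l \<Longrightarrow> altsum A l \<phi> = altsum B l \<phi>"
proof (induction l arbitrary: \<phi>)
  case (Cons x l)
  then have "A \<inter> set l = B \<inter> set l" "x \<in> A \<longleftrightarrow> x \<in> B" by auto
  with Cons.IH show ?case by simp
qed simp

lemma altsum_0 [simp]: "altsum A l (\<lambda>s. 0) = 0"
  by (induction l) auto

lemma altsum_add: "altsum A l (\<lambda>s. \<phi> s + \<psi> s) = altsum A l \<phi> + altsum A l \<psi>"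
  by (induction l arbitrary: \<phi> \<psi>) auto

lemma altsum_diff: "altsum A l (\<lambda>s. \<phi> s - \<psi> s) = altsum A l \<phi> - altsum A l \<psi>"
  by (induction l arbitrary: \<phi> \<psi>) auto

lemma altsum_mult: "altsum A l (\<lambda>s. c * \<phi> s) = c * altsum A l \<phi>"
  by (induction l arbitrary: \<phi>) (auto simp: right_diff_distrib)

lemma altsum_append:
  "altsum A (l1 @ l2) \<phi> = altsum A l1 (\<lambda>s1. altsum A l2 (\<lambda>s2. \<phi> (s1 @ s2)))"
  by (induction l1 arbitrary: \<phi>) auto

lemma altsum_swap:
  "altsum A l (\<lambda>s. altsum B m (\<lambda>t. \<phi> s t)) = altsum B m (\<lambda>t. altsum A l (\<lambda>s. \<phi> s t))"
  by (induction l arbitrary: \<phi>) (auto simp: altsum_diff)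

lemma altsum_rev: "altsum A (rev l) \<phi> = altsum A l (\<lambda>s. \<phi> (rev s))"
  by (induction l arbitrary: \<phi>) (auto simp: altsum_append altsum_diff)

lemma tau_altsum: "tau (\<lambda>r. altsum A l (\<lambda>s. \<phi> s r)) Y D = altsum A l (\<lambda>s. tau (\<phi> s) Y D)"
  by (induction Y arbitrary: D) (auto split: list.split simp: altsum_add altsum_mult simp del: mult_pCons_left)

section \<open>Positivity of the token recursion\<close>

definition nonneg_coeffs :: "int poly \<Rightarrow> bool" where
  "nonneg_coeffs p \<longleftrightarrow> (\<forall>k. 0 \<le> coeff p k)"

lemma nonneg_coeffs_add: "nonneg_coeffs p \<Longrightarrow> nonneg_coeffs q \<Longrightarrow> nonneg_coeffs (p + q)"
  by (simp add: nonneg_coeffs_def)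

lemma nonneg_coeffs_beta: "nonneg_coeffs p \<Longrightarrow> nonneg_coeffs ([:0, 1:] * p)"
  by (simp add: nonneg_coeffs_def coeff_pCons split: nat.split)

lemma one_plus_beta_mult: "[:1, 1:] * p = p + [:0, 1:] * (p :: int poly)"
  by simp

text \<open>The optional letters at the front of \<open>D\<close> increase up to the first fixed letter. Whichever of them
  are dropped, the token is then the smallest of these letters still present.\<close>
primrec pending :: "nat set \<Rightarrow> nat list \<Rightarrow> bool" where
  "pending A [] = True"
| "pending A (x # E) = (x \<in> A \<longrightarrow> pending A E \<and> (E = [] \<or> x < hd E))"

text \<open>The letters of w are present whatever A says. Moving letters from D to w makes sums with
  different optional sets comparable.\<close>

definition tausum :: "(nat list \<Rightarrow> int poly) \<Rightarrow> nat set \<Rightarrow> nat list \<Rightarrow> nat list \<Rightarrow> nat list \<Rightarrow> int poly" where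
  "tausum \<phi> A Y w D = altsum A Y (\<lambda>Y0. altsum A D (\<lambda>s. tau \<phi> Y0 (w @ s)))"

lemma tausum_Cons:
  "tausum \<phi> A Y w (x # D) = tausum \<phi> A Y (w @ [x]) D - (if x \<in> A then tausum \<phi> A Y w D else 0)"
  by (simp add: tausum_def altsum_diff)

lemma tausum_cong_set:
  assumes "A \<inter> (set Y \<union> set D) = B \<inter> (set Y \<union> set D)"
  shows "tausum \<phi> A Y w D = tausum \<phi> B Y w D"
proof -
  have "A \<inter> set Y = B \<inter> set Y" "A \<inter> set D = B \<inter> set D" using assms by auto
  then show ?thesis by (simp add: tausum_def altsum_cong_set[of A Y B] altsum_cong_set[of A D B])
qed

text \<open>Every letter that can head D after deletions exceeds y, so each term makes the same
  forced exchange; if nothing is left, y becomes the token as well.\<close>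

lemma altsum_tau_small:
  "pending A D \<Longrightarrow> D = [] \<or> y < hd D \<Longrightarrow>
    altsum A D (tau \<phi> (y # Y)) = altsum A D (\<lambda>s. tau \<phi> Y (y # s))"
  by (induction D) auto

text \<open>The lower bound, rather than mere positivity, is what remains to be shown when the removed
  smallest letter is itself optional: it comes from the term in which no token jumps. The last summand
  in the case \<open>bold\<close> is a word that has lost two letters, so \<open>P\<close> has to be closed under deletion.\<close>
lemma tausum_positive:
  fixes P :: "nat list \<Rightarrow> nat set \<Rightarrow> bool"
  assumes dist: "\<And>R A. P R A \<Longrightarrow> distinct R"
    and del: "\<And>u x v A. P (u @ x # v) A \<Longrightarrow> P (u @ v) A"
    and shrink: "\<And>R A x. P R A \<Longrightarrow> x \<in> set R \<Longrightarrow> P R (A - {x})"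
    and swap: "\<And>u x y v A. P (u @ y # x # v) A \<Longrightarrow> x < y \<Longrightarrow> x \<notin> A \<Longrightarrow> P (u @ x # y # v) A"
    and pat: "\<And>R A s b t. P R A \<Longrightarrow> subseq [s, b, t] R \<Longrightarrow> b < t \<Longrightarrow> t < s \<Longrightarrow> b \<notin> A"
    and pos: "\<And>R A. P R A \<Longrightarrow> nonneg_coeffs (altsum A R \<phi>)"
  shows "P (rev Y @ D) A \<Longrightarrow> pending A D \<Longrightarrow>
    nonneg_coeffs (tausum \<phi> A Y [] D - altsum A (rev Y @ D) \<phi>)"
proof (induction Y arbitrary: D A)
  case Nil
  have "altsum A D (tau \<phi> []) = altsum A D \<phi>" by (rule altsum_cong) simp
  then show ?case by (simp add: tausum_def nonneg_coeffs_def)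
next
  case (Cons y Y)
  have PD: "P (rev Y @ y # D) A" using Cons.prems by simp
  have d: "distinct (rev Y @ y # D)" by (rule dist[OF PD])
  have IH0: "nonneg_coeffs (tausum \<phi> B Y [] E)" if "P (rev Y @ E) B" "pending B E" for B E
    using nonneg_coeffs_add[OF Cons.IH[OF that] pos[OF that(1)]] by simp
  \<comment> \<open>If y is optional, fixing it adds back the words without y, whose sum is
    nonnegative by closure under deletion.\<close>
  have low: "nonneg_coeffs (altsum (A - {y}) (rev Y @ y # D) \<phi> - altsum A (rev Y @ y # D) \<phi>)"
  proof -
    have *: "altsum (A - {y}) l \<psi> = altsum A l \<psi>" if "y \<notin> set l" for l \<psi>
      using that by (intro altsum_cong_set) auto
    have "altsum (A - {y}) (rev Y @ y # D) \<phi> - altsum A (rev Y @ y # D) \<phi> =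
        (if y \<in> A then altsum A (rev Y @ D) \<phi> else 0)"
      using d by (simp add: altsum_append * altsum_diff)
    then show ?thesis using pos[OF del[OF PD]] by (auto simp: nonneg_coeffs_def)
  qed
  let ?Wy = "altsum A Y (\<lambda>Y0. altsum A D (tau \<phi> (y # Y0)))"
  have W: "tausum \<phi> A (y # Y) [] D = ?Wy - (if y \<in> A then tausum \<phi> A Y [] D else 0)"
    by (simp add: tausum_def)
  have T: "tausum \<phi> (A - S) Y w E = tausum \<phi> A Y w E" if "S \<inter> (set Y \<union> set E) = {}" for S w E
    using that by (intro tausum_cong_set) auto
  \<comment> \<open>The head of D is absent or above y (no choice for the token), fixed and below y,
    or optional and below y.\<close>
  consider (small) "D = [] \<or> y < hd D"
    | (skip) x E where "D = x # E" "x < y" "x \<notin> A"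
    | (bold) c E where "D = c # E" "c < y" "c \<in> A"
  proof (cases D)
    case (Cons c E)
    moreover have "y < c \<or> c < y" using d Cons by (auto simp: neq_iff)
    ultimately show thesis using that by (metis list.sel(1))
  qed (rule that(1), simp)
  then show ?case
  proof cases
    case small
    have "?Wy = tausum \<phi> A Y [y] D"
      using altsum_tau_small[OF Cons.prems(2) small] by (simp add: tausum_def)
    then have "tausum \<phi> A (y # Y) [] D = tausum \<phi> A Y [] (y # D)"
      by (simp add: W tausum_Cons)
    moreover have "pending A (y # D)" using small Cons.prems(2) by auto
    ultimately show ?thesis using Cons.IH[OF PD] by simp
  next
    case skip
    have Wy: "?Wy = [:1, 1:] * tausum \<phi> A Y [y, x] E + tausum \<phi> A Y [x, y] E"
      using skip by (simp add: tausum_def altsum_add altsum_mult del: mult_pCons_left)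
    have P1: "P (rev Y @ y # x # E) (A - {y})" using shrink[OF PD, of y] skip by simp
    have P2: "P (rev Y @ x # y # E) A" using swap PD skip by simp
    have 1: "tausum \<phi> (A - {y}) Y [] (y # x # E) = tausum \<phi> A Y [y, x] E"
      using skip d by (simp add: tausum_Cons T)
    have 2: "tausum \<phi> A Y [] (x # y # E) = tausum \<phi> A Y [x, y] E - (if y \<in> A then tausum \<phi> A Y [x] E else 0)"
      using skip by (simp add: tausum_Cons)
    \<comment> \<open>After an exchange y counts as fixed. After a jump y stays as it was, and the
      negative term without y is precisely its deletion there. One copy of the exchange term will
      carry the lower bound, the other has weight \<beta>.\<close>
    have "tausum \<phi> A (y # Y) [] D =
        tausum \<phi> (A - {y}) Y [] (y # x # E) + [:0, 1:] * tausum \<phi> (A - {y}) Y [] (y # x # E)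
        + tausum \<phi> A Y [] (x # y # E)"
      unfolding W Wy 1 2 using skip by (simp add: tausum_Cons one_plus_beta_mult algebra_simps del: mult_pCons_left)
    then have "tausum \<phi> A (y # Y) [] D - altsum A (rev (y # Y) @ D) \<phi> =
       (tausum \<phi> (A - {y}) Y [] (y # x # E) - altsum (A - {y}) (rev Y @ y # x # E) \<phi>)
       + (altsum (A - {y}) (rev Y @ y # D) \<phi> - altsum A (rev Y @ y # D) \<phi>)
       + [:0, 1:] * tausum \<phi> (A - {y}) Y [] (y # x # E)
       + tausum \<phi> A Y [] (x # y # E)"
      using skip by simp
    moreover have "nonneg_coeffs \<dots>"
      using skip by (intro nonneg_coeffs_add nonneg_coeffs_beta Cons.IH IH0 low P1 P2) auto
    ultimately show ?thesis by (simp only:)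
  next
    case bold
    have pE: "pending A E" "E = [] \<or> c < hd E" using Cons.prems(2) bold by auto
    \<comment> \<open>Otherwise y, c and the head of E would form a 312 with optional smallest
      letter c. So if c is dropped, the exchange with y is forced.\<close>
    have hE: "E = [] \<or> y < hd E"
    proof (cases E)
      case (Cons t E')
      have "subseq [y, c, t] (rev Y @ y # D)" using bold Cons by (simp add: subseq_drop_many)
      then have "\<not> t < y" using pat[OF PD, of y c t] pE bold Cons by auto
      moreover have "t \<noteq> y" using d bold Cons by auto
      ultimately show ?thesis using Cons by simp
    qed simp
    have "?Wy = [:1, 1:] * tausum \<phi> A Y [y, c] E + tausum \<phi> A Y [c, y] E - tausum \<phi> A Y [y] E"
      using bold altsum_tau_small[OF pE(1) hE]
      by (simp add: tausum_def altsum_add altsum_diff altsum_mult del: mult_pCons_left)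
    note W' = W[unfolded this]
    have P1: "P (rev Y @ y # c # E) (A - {y})" using shrink[OF PD, of y] bold by simp
    have P2: "P (rev Y @ y # c # E) (A - {y} - {c})" using shrink[OF P1, of c] by simp
    have P3: "P (rev Y @ c # y # E) (A - {c})" using swap shrink[OF PD, of c] bold by simp
    have P4: "P (rev Y @ E) A" using del[OF del[OF PD[unfolded bold]]] .
    have E: "nonneg_coeffs (if y \<in> A then tausum \<phi> A Y [] E else 0)"
      using IH0[OF P4 pE(1)] by (simp add: nonneg_coeffs_def)
    have 1: "tausum \<phi> (A - {y}) Y [] (y # c # E) = tausum \<phi> A Y [y, c] E - tausum \<phi> A Y [y] E"
      using bold d by (simp add: tausum_Cons T)
    have 2: "tausum \<phi> (A - {y} - {c}) Y [] (y # c # E) = tausum \<phi> A Y [y, c] E"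
      using bold d T[of "{c, y}"] by (simp add: tausum_Cons flip: Diff_insert)
    have 3: "tausum \<phi> (A - {c}) Y [] (c # y # E) =
        tausum \<phi> A Y [c, y] E - (if y \<in> A then tausum \<phi> A Y [c] E else 0)"
      using bold d by (simp add: tausum_Cons T)
    \<comment> \<open>Regrouped into: y fixed and c as before; both fixed, with weight \<beta>; c
      jumped and hence fixed, y as before; both dropped. The induction applies to each group
      separately.\<close>
    have "tausum \<phi> A (y # Y) [] D =
        tausum \<phi> (A - {y}) Y [] (y # c # E) + [:0, 1:] * tausum \<phi> (A - {y} - {c}) Y [] (y # c # E)
        + tausum \<phi> (A - {c}) Y [] (c # y # E) + (if y \<in> A then tausum \<phi> A Y [] E else 0)"
      unfolding W' 1 2 3 using bold by (simp add: tausum_Cons one_plus_beta_mult algebra_simps del: mult_pCons_left)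
    then have "tausum \<phi> A (y # Y) [] D - altsum A (rev (y # Y) @ D) \<phi> =
       (tausum \<phi> (A - {y}) Y [] (y # c # E) - altsum (A - {y}) (rev Y @ y # c # E) \<phi>)
       + (altsum (A - {y}) (rev Y @ y # D) \<phi> - altsum A (rev Y @ y # D) \<phi>)
       + [:0, 1:] * tausum \<phi> (A - {y} - {c}) Y [] (y # c # E)
       + tausum \<phi> (A - {c}) Y [] (c # y # E)
       + (if y \<in> A then tausum \<phi> A Y [] E else 0)"
      using bold by simp
    moreover have "nonneg_coeffs \<dots>"
      by (intro nonneg_coeffs_add nonneg_coeffs_beta Cons.IH IH0 low P1 P2 P3 E) auto
    ultimately show ?thesis by (simp only:)
  qed
qed

section \<open>The weakened avoidance of 1423 and the induction on the smallest letter\<close>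

lemma subseq_swap_cases:
  assumes "subseq l (u @ x # y # v)"
  obtains "subseq l (u @ y # x # v)"
    | l1 l2 where "l = l1 @ x # y # l2" "subseq l1 u" "subseq l2 v"
proof -
  obtain l1 l2 where l: "l = l1 @ l2" "subseq l1 u" "subseq l2 (x # y # v)"
    using assms by (metis subseq_appendE)
  show thesis
  proof (cases "\<exists>l3. l2 = x # y # l3 \<and> subseq l3 v")
    case True
    then show ?thesis using that l by blast
  next
    case False
    \<comment> \<open>A subword not using both x and y does not notice their exchange.\<close>
    have "subseq l2 (y # x # v)"
    proof (cases l2)
      case (Cons z l3)
      show ?thesis
      proof (cases "z = x")
        case True
        have "subseq l3 v"
          using l(3) False by (cases l3) (auto simp: Cons True split: if_splits)
        then show ?thesis unfolding Cons True by (intro list_emb_Cons subseq_Cons2)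
      next
        case False
        then have "subseq l2 (y # v)" using l(3) Cons by simp
        moreover have "subseq (y # v) (y # x # v)" by (intro subseq_Cons2 list_emb_Cons) simp
        ultimately show ?thesis by (rule subseq_order.trans)
      qed
    qed simp
    then show ?thesis using that(1) l list_emb_append_mono by blast
  qed
qed

definition two_avoids :: "nat set \<Rightarrow> nat list \<Rightarrow> bool" where
  "two_avoids A w \<longleftrightarrow> (\<forall>a d b c. subseq [a, d, b, c] w \<longrightarrow> a < b \<longrightarrow> b < c \<longrightarrow> c < d \<longrightarrow> b \<notin> A)"

text \<open>\<open>ups_split\<close> removes the smallest letter m, and
  \<open>tausum_positive\<close> treats the letters to its right; the positivity it asks for is the
  induction hypothesis.\<close>

theorem altsum_ups_nonneg:
  "distinct w \<Longrightarrow> two_avoids A w \<Longrightarrow> nonneg_coeffs (altsum A w ups)"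
proof (induction "length w" arbitrary: w A rule: less_induct)
  case less
  show ?case
  proof (cases "w = []")
    case True
    then show ?thesis by (simp add: ups_def nonneg_coeffs_def)
  next
    case False
    obtain L m R where w: "w = L @ m # R" and m: "\<forall>x\<in>set L \<union> set R. m < x"
      using split_Min[OF less.prems(1) False] by metis
    have dLR: "distinct (L @ R)" "m \<notin> set L" "m \<notin> set R" using less.prems by (auto simp: w)
    \<comment> \<open>The letters left of m never move and are summed out once.\<close>
    define \<Phi> where "\<Phi> = (\<lambda>r. altsum A L (\<lambda>l. ups (l @ r)))"
    \<comment> \<open>The length bound makes \<open>L @ r\<close> shorter than w, so that the
      induction hypothesis applies. The 312 condition is inherited from m standing before R, and
      prevents swaps from creating a forbidden 1423.\<close>
    define P where "P = (\<lambda>r B. distinct (L @ r) \<and> B \<inter> set L = A \<inter> set L \<and> length r \<le> length R \<and>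
       (\<forall>s b t. subseq [s, b, t] r \<longrightarrow> b < t \<longrightarrow> t < s \<longrightarrow> b \<notin> B) \<and> two_avoids B (L @ r))"
    have \<Phi>: "altsum B r \<Phi> = altsum B (L @ r) ups" if "B \<inter> set L = A \<inter> set L" for B r
      unfolding \<Phi>_def altsum_append using altsum_cong_set[OF that] by (simp add: altsum_swap[of A L])
    have main: "nonneg_coeffs (tausum \<Phi> A (rev R) [] [] - altsum A (rev (rev R) @ []) \<Phi>)"
    proof (rule tausum_positive[where P = P])
      show "distinct r" if "P r B" for r B using that by (simp add: P_def)
      show "P (u @ v) B" if "P (u @ x # v) B" for u x v B
      proof -
        have s1: "subseq (u @ v) (u @ x # v)" by (intro list_emb_append_mono) auto
        have s2: "subseq (L @ u @ v) (L @ u @ x # v)"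
          by (rule list_emb_append_mono[OF subseq_order.refl s1])
        show ?thesis using that unfolding P_def two_avoids_def
          by (auto intro: subseq_order.trans[OF _ s1] subseq_order.trans[OF _ s2]) 
            (meson s1 s2 subseq_order.trans)+
      qed
      show "P r (B - {x})" if "P r B" "x \<in> set r" for r B x
        using that unfolding P_def two_avoids_def by auto
      show "P (u @ x # y # v) B" if p: "P (u @ y # x # v) B" and xy: "x < y" and xB: "x \<notin> B" for u x y v B
      proof -
        have p3: "b \<notin> B" if "subseq [s, b, t] (u @ y # x # v)" "b < t" "t < s" for s b t
          using p that by (simp add: P_def)
        have p4: "b \<notin> B" if "subseq [a, d, b, c] (L @ u @ y # x # v)" "a < b" "b < c" "c < d" for a d b c
          using p that by (auto simp: P_def two_avoids_def)
        have "b \<notin> B" if sub: "subseq [s, b, t] (u @ x # y # v)" and lt: "b < t" "t < s" for s b t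
          using sub
        proof (cases rule: subseq_swap_cases)
          case 1
          then show ?thesis using p3 lt by blast
        next
          case (2 l1 l2)
          \<comment> \<open>The first possibility contradicts x < y; in the second b is the jumped
            letter x, which is not optional.\<close>
          then have "(s, b) = (x, y) \<or> (b, t) = (x, y)"
            by (auto simp: Cons_eq_append_conv)
          then show ?thesis using lt xy xB by auto
        qed
        moreover have "b \<notin> B"
          if sub: "subseq [a, d, b, c] (L @ u @ x # y # v)" and lt: "a < b" "b < c" "c < d" for a d b c
          using sub unfolding append_assoc[symmetric]
        proof (cases rule: subseq_swap_cases)
          case 1
          then show ?thesis using p4 lt by simp
        next
          case (2 l1 l2)
          \<comment> \<open>A new 1423 has x, y as consecutive letters. As 1 and 4 they leave y, b,
            c, a 312 present before the swap; as 4 and 2 they contradict x < y; as 2 and 3 the 2 is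
            x, not optional.\<close>
          then have "(a, d) = (x, y) \<and> l2 = [b, c] \<or> (d, b) = (x, y) \<or> (b, c) = (x, y)"
            by (auto simp: Cons_eq_append_conv)
          moreover have "b \<notin> B" if "d = y" "l2 = [b, c]"
          proof -
            have "subseq [b, c] (x # v)" by (rule list_emb_Cons) (use 2 that in simp)
            then have "subseq [d, b, c] (u @ y # x # v)"
              unfolding \<open>d = y\<close> by (intro subseq_drop_many subseq_Cons2)
            then show ?thesis using p3 lt by blast
          qed
          ultimately show ?thesis using lt xy xB by auto
        qed
        ultimately show ?thesis using p by (auto simp: P_def two_avoids_def)
      qed
      show "b \<notin> B" if "P r B" "subseq [s, b, t] r" "b < t" "t < s" for r B s b t
        using that by (simp add: P_def)
      show "nonneg_coeffs (altsum B r \<Phi>)" if p: "P r B" for r B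
      proof -
        have "nonneg_coeffs (altsum B (L @ r) ups)"
          by (rule less.hyps) (use p w in \<open>auto simp: P_def\<close>)
        then show ?thesis using p by (simp add: P_def \<Phi>)
      qed
      show "P (rev (rev R) @ []) A"
      proof -
        have "b \<notin> A" if "subseq [s, b, t] R" "b < t" "t < s" for s b t
        proof -
          \<comment> \<open>Putting m before a 312 in R gives a 1423 in w with b in the role of
            2.\<close>
          have "subseq ([] @ [m, s, b, t]) (L @ m # R)"
            using that(1) by (intro list_emb_append_mono) auto
          moreover have "m < b" using m that(1) by (auto dest: subseq_set)
          ultimately show ?thesis using less.prems(2) that unfolding w two_avoids_def by auto
        qed
        moreover have "subseq (L @ R) w" unfolding w by (intro list_emb_append_mono) auto
        then have "two_avoids A (L @ R)"
          using less.prems(2) unfolding two_avoids_def by (meson subseq_order.trans)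
        ultimately show ?thesis using dLR by (auto simp: P_def)
      qed
    qed simp
    have "altsum A L (\<lambda>l. altsum A R (\<lambda>r. ups (l @ m # r))) =
        altsum A L (\<lambda>l. altsum A R (\<lambda>r. tau (\<lambda>r'. ups (l @ r')) (rev r) []))"
    proof (intro altsum_cong ups_split)
      fix l r assume s: "subseq l L" "subseq r R"
      have "subseq (l @ m # r) w" unfolding w using s by (intro list_emb_append_mono) auto
      then show "distinct (l @ m # r)" using less.prems(1) by (metis subseq_distinct)
      show "\<forall>x\<in>set l \<union> set r. m < x" using s m by (auto dest: subseq_set)
    qed
    also have "\<dots> = altsum A R (\<lambda>r. tau \<Phi> (rev r) [])"
      by (simp add: altsum_swap[of A L] \<Phi>_def tau_altsum)
    also have "\<dots> = tausum \<Phi> A (rev R) [] []"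
      by (simp add: tausum_def altsum_rev)
    \<comment> \<open>If m is optional, the words without it subtract exactly the lower bound from
      \<open>main\<close>; otherwise that bound is itself nonnegative by induction.\<close>
    finally have "altsum A w ups = tausum \<Phi> A (rev R) [] [] - (if m \<in> A then altsum A (L @ R) ups else 0)"
      by (simp add: w altsum_append altsum_diff)
    moreover have "nonneg_coeffs (altsum A R \<Phi>)" if "\<not> m \<in> A"
    proof -
      have "subseq (L @ R) w" unfolding w by (intro list_emb_append_mono) auto
      then have "two_avoids A (L @ R)"
        using less.prems(2) unfolding two_avoids_def by (meson subseq_order.trans)
      then show ?thesis using less.hyps[of "L @ R" A] dLR by (simp add: \<Phi> w)
    qed
    ultimately show ?thesis
      using main nonneg_coeffs_add[of "tausum \<Phi> A (rev R) [] [] - altsum A R \<Phi>" "altsum A R \<Phi>"]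
      by (cases "m \<in> A") (simp_all add: \<Phi>)
  qed
qed

section \<open>Identification with the signed sum over the subwords above u\<close>

lemma altsum_eq_sum:
  "distinct w \<Longrightarrow> subseq u w \<Longrightarrow> A \<inter> set w = set w - set u \<Longrightarrow>
   (\<Sum>v\<in>{v. subseq u v \<and> subseq v w}. (-1) ^ (length w - length v) * \<phi> v) = altsum A w \<phi>"
proof (induction w arbitrary: u \<phi>)
  case Nil
  then have "{v. subseq u v \<and> subseq v []} = {[]}" by auto
  then show ?case by simp
next
  case (Cons x w)
  have fin: "finite {v. subseq u v \<and> subseq v w}" for u
    by (rule finite_subset[of _ "set (subseqs w)"]) auto
  show ?case
  \<comment> \<open>As letters are distinct, a first letter belonging to u heads every v, while one
    outside u may be kept or dropped freely.\<close>
  proof (cases "x \<in> set u")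
    case True
    then obtain u' where u: "u = x # u'" "subseq u' w"
      using Cons.prems by (cases u) (auto simp: subseq_Cons2_iff split: if_splits dest: subseq_set)
    have A: "x \<notin> A" "A \<inter> set w = set w - set u'" using Cons.prems by (auto simp: u)
    have "{v. subseq u v \<and> subseq v (x # w)} = (#) x ` {v. subseq u' v \<and> subseq v w}"
    proof (intro set_eqI iffI)
      fix v assume v: "v \<in> {v. subseq u v \<and> subseq v (x # w)}"
      have "x \<in> set v" using v u by (auto dest: subseq_set)
      then obtain v' where "v = x # v'" "subseq v' w"
        using v Cons.prems(1) by (cases v) (auto simp: subseq_Cons2_iff split: if_splits dest: subseq_set)
      then show "v \<in> (#) x ` {v. subseq u' v \<and> subseq v w}" using v u by auto
    qed (auto simp: u)
    then have "(\<Sum>v\<in>{v. subseq u v \<and> subseq v (x # w)}. (-1) ^ (length (x # w) - length v) * \<phi> v)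
      = (\<Sum>v\<in>{v. subseq u' v \<and> subseq v w}. (-1) ^ (length w - length v) * \<phi> (x # v))"
      by (simp add: sum.reindex)
    also have "\<dots> = altsum A w (\<lambda>v. \<phi> (x # v))"
      using Cons.IH[of u'] Cons.prems u A by simp
    finally show ?thesis using A by simp
  next
    case False
    then have u: "subseq u w" using Cons.prems by (cases u) (auto simp: subseq_Cons2_iff split: if_splits)
    have A: "x \<in> A" "A \<inter> set w = set w - set u" using Cons.prems False by auto
    let ?S = "{v. subseq u v \<and> subseq v w}"
    have S: "{v. subseq u v \<and> subseq v (x # w)} = (#) x ` ?S \<union> ?S"
    proof (intro set_eqI iffI)
      fix v assume v: "v \<in> {v. subseq u v \<and> subseq v (x # w)}"
      show "v \<in> (#) x ` ?S \<union> ?S"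
      proof (cases v)
        case (Cons z v')
        then show ?thesis
          using v False by (cases "z = x"; cases u) (auto simp: subseq_Cons2_iff split: if_splits)
      qed (use v in auto)
    qed auto
    have disj: "(#) x ` ?S \<inter> ?S = {}" using Cons.prems(1) by (auto dest: subseq_set)
    \<comment> \<open>Dropping x adds one to the number of deleted letters, hence the sign.\<close>
    have "(\<Sum>v\<in>?S. (-1) ^ (length (x # w) - length v) * \<phi> v) =
        - (\<Sum>v\<in>?S. (-1) ^ (length w - length v) * \<phi> v)"
      unfolding sum_negf[symmetric]
      by (rule sum.cong) (auto simp: Suc_diff_le dest: list_emb_length)
    then show ?thesis
      unfolding S using Cons.IH[OF _ u A(2)] Cons.prems(1) A(1)
      by (subst sum.union_disjoint[OF _ _ disj]) (auto simp: fin sum.reindex)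
  qed
qed

theorem theorem1p5:
  fixes w u :: "nat list"
  assumes "is_perm w"
    and "avoids w [1, 4, 2, 3]"
    and "subseq u w"
  shows "\<forall>k. 0 \<le> coeff (\<Sum>v\<in>{v. subseq u v \<and> subseq v w}.
                 (-1) ^ (length w - length v) * Upsilon (std v)) k"
proof -
  have d: "distinct w" using assms(1) by (simp add: is_perm_def)
  have "std [a, d, b, c] = [1, 4, 2, 3]" if "a < b" "b < c" "c < d" for a b c d :: nat
  proof -
    have "{y \<in> set [a, d, b, c]. y \<le> a} = {a}" "{y \<in> set [a, d, b, c]. y \<le> b} = {a, b}"
      "{y \<in> set [a, d, b, c]. y \<le> c} = {a, b, c}" "{y \<in> set [a, d, b, c]. y \<le> d} = {a, b, c, d}"
      using that by auto
    with that show ?thesis unfolding std_def by simp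
  qed
  \<comment> \<open>Full avoidance gives the weakened condition for any optional set, here applied
    to the letters outside u.\<close>
  then have "two_avoids A w" for A using assms(2) by (auto simp: two_avoids_def avoids_def)
  then have "nonneg_coeffs (altsum (set w - set u) w ups)" by (rule altsum_ups_nonneg[OF d])
  moreover have "(\<Sum>v\<in>{v. subseq u v \<and> subseq v w}. (-1) ^ (length w - length v) * Upsilon (std v))
      = (\<Sum>v\<in>{v. subseq u v \<and> subseq v w}. (-1) ^ (length w - length v) * ups v)"
    by (rule sum.cong) (auto simp: Upsilon_std subseq_distinct[OF _ d])
  moreover have "\<dots> = altsum (set w - set u) w ups"
    by (rule altsum_eq_sum[OF d assms(3)]) auto
  ultimately show ?thesis by (simp add: nonneg_coeffs_def)
qed

end
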